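(* Suppose $T$ is a triangulation of a polygon endowed with an orientation of its edges (encoding a spin structure). Let $i$ and $j$ be two vertices of the polygon, let $i'$ and $j'$ be any vertices of the graph $\Gamma_T$ that are near $i$ and $j$ respectively, and let $H$ be the holonomy (of the connection described below) from $i'$ to $j'$. Then the $(1,2)$-entry of $H$ is equal to $\pm \lambda_{ij}$.
   Context: Setting (decorated super Teichmüller space of a polygon, after Penner–Zeitlin): $P$ is a polygon (a disc with marked points on its boundary), $T$ a triangulation of $P$, and each edge of $T$ carries an orientation. One works in a super-commutative algebra $\mathcal{A}$ containing an even element $\lambda_{ij}$ (the $\lambda$-length) for each arc with endpoints $i,j$ and an odd element $\boxed{ijk}$ (the $\mu$-invariant) for each triangle $ijk$; those for arcs/triangles not in $T$ are obtained from the ones of $T$ via super Ptolemy transformations (flips). The $h$-length at vertex $i$ of a triangle $ijk$ is $h^i_{jk}=\frac{\lambda_{jk}}{\lambda_{ij}\lambda_{ik}}$, and the normalized $\mu$-invariant is $\sqrt{h^i_{jk}}\,\boxed{ijk}$. Matrices ($2|1\times 2|1$ supermatrices, rows/columns ordered even, even | odd; all lie in $\mathrm{OSp}(1|2)$): for even $x,h$ and odd $\theta$, $E(x)=\begin{pmatrix}0&-x&0\\ 1/x&0&0\\ 0&0&1\end{pmatrix}$, $A(h|\theta)=\begin{pmatrix}1&0&0\\ h&1&-\sqrt{h}\,\theta\\ \sqrt{h}\,\theta&0&1\end{pmatrix}$, $\rho=\begin{pmatrix}-1&0&0\\0&-1&0\\0&0&1\end{pmatrix}$, with $E_{ij}:=E(\lambda_{ij})$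 and $A^i_{jk}:=A(h^i_{jk}\,|\,\boxed{ijk})$. The graph $\Gamma_T$: inside each triangle of $T$ there is a hexagonal face of $\Gamma_T$ with three sides parallel to the sides of the triangle (the other three sides correspond to the angles of the triangle); when two triangles share a side, the two vertices of $\Gamma_T$ on opposite sides of this edge are connected (so each internal diagonal is crossed by two edges of $\Gamma_T$). A vertex of $\Gamma_T$ is near the polygon vertex $i$ if it is one of the endpoints of the hexagon-edges corresponding to the angles at $i$ of the triangles incident to $i$. Connection on $\Gamma_T$ (opposite orientations of an edge get inverse matrices): inside triangle $ijk$, the clockwise orientation of the hexagon edge at angle $i$ is assigned $A^i_{jk}$; the clockwise orientation of the hexagon edge parallel to side $ij$ is assigned $E_{ij}$; for an internal diagonal $ij$ oriented $i\to j$, of the two edges of $\Gamma_T$ crossing it, the one closer to $i$ is assigned the identity and the one closer to $j$ is assigned $\rho$. The holonomy of a path is the product of the matrices along the path, with each later edge multiplied on the left. *)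

theory Defs
  imports "HOL-Analysis.Analysis"
begin

section \<open>Super-commutative algebras with positive elements\<close>

text \<open>
  A super-commutative real algebra with even part \<open>Ev\<close>, odd part \<open>Od\<close> and a set \<open>Pos\<close> of
  admissible values for \<open>\<lambda>\<close>-lengths.  In a Grassmann algebra over the reals, \<open>Pos\<close> is the set of
  even elements with positive body.  The axioms on \<open>Pos\<close> say only what is needed for the
  quotients and square roots in the super Ptolemy relations to make sense: positive elements are
  invertible, have exactly one positive square root, and stay positive when a product of two
  odd elements is added.
\<close>

locale positive_superalgebra =
  fixes Ev Od Pos :: "'a::real_algebra_1 set"
  assumes subspace_Ev: "subspace Ev"
    and subspace_Od: "subspace Od"
    and Ev_Int_Od: "Ev \<inter> Od = {0}"
    and Ev_plus_Od: "\<exists>a\<in>Ev. \<exists>b\<in>Od. x = a + b"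
    and one_Ev: "1 \<in> Ev"
    and Ev_Ev: "\<lbrakk>x \<in> Ev; y \<in> Ev\<rbrakk> \<Longrightarrow> x * y \<in> Ev"
    and Ev_Od: "\<lbrakk>x \<in> Ev; y \<in> Od\<rbrakk> \<Longrightarrow> x * y \<in> Od"
    and Od_Od: "\<lbrakk>x \<in> Od; y \<in> Od\<rbrakk> \<Longrightarrow> x * y \<in> Ev"
    and Ev_central: "x \<in> Ev \<Longrightarrow> x * y = y * x"
    and Od_anticommute: "\<lbrakk>x \<in> Od; y \<in> Od\<rbrakk> \<Longrightarrow> x * y = - (y * x)"
    and Pos_Ev: "Pos \<subseteq> Ev"
    and one_Pos: "1 \<in> Pos"
    and Pos_add: "\<lbrakk>x \<in> Pos; y \<in> Pos\<rbrakk> \<Longrightarrow> x + y \<in> Pos"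
    and Pos_mult: "\<lbrakk>x \<in> Pos; y \<in> Pos\<rbrakk> \<Longrightarrow> x * y \<in> Pos"
    and Pos_inverse: "x \<in> Pos \<Longrightarrow> \<exists>y\<in>Pos. x * y = 1"
    and Pos_sqrt: "x \<in> Pos \<Longrightarrow> \<exists>!y. y \<in> Pos \<and> y * y = x"
    and Pos_add_Od_Od: "\<lbrakk>x \<in> Pos; y \<in> Od; z \<in> Od\<rbrakk> \<Longrightarrow> x + y * z \<in> Pos"

definition ring_inv :: "'a::ring_1 \<Rightarrow> 'a" where
  "ring_inv x = (THE y. x * y = 1 \<and> y * x = 1)"

definition pos_sqrt :: "'a::ring_1 set \<Rightarrow> 'a \<Rightarrow> 'a" where
  "pos_sqrt Pos x = (THE y. y \<in> Pos \<and> y * y = x)"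

section \<open>Triangulated polygons\<close>

text \<open>
  The vertices of an \<open>n\<close>-gon are \<open>0, \<dots>, n - 1\<close>, numbered clockwise along the boundary.
  Arcs (sides and diagonals) are 2-element sets of vertices.  \<open>cw i j k\<close> says that \<open>i, j, k\<close> are
  distinct and met in this order when going clockwise around the boundary.
\<close>

definition cw :: "nat \<Rightarrow> nat \<Rightarrow> nat \<Rightarrow> bool" where
  "cw i j k \<longleftrightarrow> i < j \<and> j < k \<or> j < k \<and> k < i \<or> k < i \<and> i < j"

definition polygon_arcs :: "nat \<Rightarrow> nat set set" where
  "polygon_arcs n = {{i, j} | i j. i < n \<and> j < n \<and> i \<noteq> j}"

definition crossing :: "nat set \<Rightarrow> nat set \<Rightarrow> bool" where
  "crossing e f \<longleftrightarrow> (\<exists>a b c d. e = {a, c} \<and> f = {b, d} \<and> cw a b c \<and> cw c d a)"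

text \<open>The sides of the polygon cross no arc, so by maximality they belong to every triangulation.\<close>

definition triangulation :: "nat \<Rightarrow> nat set set \<Rightarrow> bool" where
  "triangulation n T \<longleftrightarrow>
     T \<subseteq> polygon_arcs n \<and>
     (\<forall>e\<in>T. \<forall>f\<in>T. \<not> crossing e f) \<and>
     (\<forall>e\<in>polygon_arcs n. (\<forall>f\<in>T. \<not> crossing e f) \<longrightarrow> e \<in> T)"

text \<open>
  Three arcs of a triangulated polygon that are the sides of a triangle always bound a face,
  since there are no marked points in the interior.
\<close>

definition triangles :: "nat set set \<Rightarrow> nat set set" where
  "triangles T =
     {{i, j, k} | i j k. i \<noteq> j \<and> j \<noteq> k \<and> i \<noteq> k \<and> {i, j} \<in> T \<and> {j, k} \<in> T \<and> {i, k} \<in> T}"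

text \<open>An arc oriented from \<open>i\<close> to \<open>j\<close> is recorded as the pair \<open>(i, j)\<close>.\<close>

definition edge_orientation :: "nat set set \<Rightarrow> (nat \<times> nat) set \<Rightarrow> bool" where
  "edge_orientation T R \<longleftrightarrow>
     (\<forall>(i, j)\<in>R. {i, j} \<in> T) \<and>
     (\<forall>i j. {i, j} \<in> T \<longrightarrow> ((i, j) \<in> R \<longleftrightarrow> (j, i) \<notin> R))"

definition reverse_edge :: "nat \<Rightarrow> nat \<Rightarrow> (nat \<times> nat) set \<Rightarrow> (nat \<times> nat) set" where
  "reverse_edge a b R = {(x, y). if {x, y} = {a, b} then (y, x) \<in> R else (x, y) \<in> R}"

section \<open>Decorations and super Ptolemy transformations\<close>

text \<open>
  Only the values of \<open>lam\<close> on \<open>arcs\<close> and of \<open>mu\<close> on the triangles of \<open>arcs\<close> are meaningful.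
\<close>

record 'a decoration =
  arcs :: "nat set set"
  orient :: "(nat \<times> nat) set"
  lam :: "nat set \<Rightarrow> 'a"
  mu :: "nat set \<Rightarrow> 'a"

definition decorated_polygon ::
    "'a::real_algebra_1 set \<Rightarrow> 'a set \<Rightarrow> nat \<Rightarrow> 'a decoration \<Rightarrow> bool" where
  "decorated_polygon Od Pos n D \<longleftrightarrow>
     triangulation n (arcs D) \<and> edge_orientation (arcs D) (orient D) \<and>
     (\<forall>e\<in>arcs D. lam D e \<in> Pos) \<and> (\<forall>t\<in>triangles (arcs D). mu D t \<in> Od)"

text \<open>
  The flip of a diagonal \<open>e\<close> oriented from \<open>v0\<close> to \<open>v2\<close>, in the quadrilateral with vertices
  \<open>v0, v1, v2, v3\<close> in clockwise order; thus \<open>v1\<close> lies to the left of \<open>e\<close> and \<open>v3\<close> to the right.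
  With sides \<open>a = v0v1\<close>, \<open>b = v1v2\<close>, \<open>c = v2v3\<close>, \<open>d = v3v0\<close>, with \<open>\<theta>\<close> and \<open>\<sigma>\<close> the
  \<open>\<mu>\<close>-invariants of the triangles to the left and to the right of \<open>e\<close>, and with
  \<open>chi = ac/(bd)\<close>, the relations of Penner and Zeitlin are
  \<open>ef = (ac + bd) (1 + \<sigma>\<theta>\<surd>chi/(1 + chi))\<close>, \<open>\<theta>' = (\<theta> + \<surd>chi \<sigma>)/\<surd>(1 + chi)\<close> and
  \<open>\<sigma>' = (\<sigma> - \<surd>chi \<theta>)/\<surd>(1 + chi)\<close>.  The triangle of \<open>\<theta>'\<close> contains the tail \<open>v0\<close> of \<open>e\<close>, and
  that of \<open>\<sigma>'\<close> its head \<open>v2\<close>.  The new diagonal is oriented from \<open>v3\<close> to \<open>v1\<close> and the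
  orientation of \<open>b\<close> is reversed.  No relation is needed for the opposite orientation of \<open>e\<close>:
  it is covered by renaming the vertices.
\<close>

inductive super_flip :: "'a::real_algebra_1 set \<Rightarrow> 'a decoration \<Rightarrow> 'a decoration \<Rightarrow> bool"
  for Pos :: "'a set" and D :: "'a decoration" where
  "\<lbrakk>cw v0 v1 v2; cw v2 v3 v0; (v0, v2) \<in> orient D;
    {v0, v1, v2} \<in> triangles (arcs D); {v0, v2, v3} \<in> triangles (arcs D);
    a = lam D {v0, v1}; b = lam D {v1, v2}; c = lam D {v2, v3}; d = lam D {v3, v0};
    e = lam D {v0, v2}; \<theta> = mu D {v0, v1, v2}; \<sigma> = mu D {v0, v2, v3};
    chi = a * c * ring_inv (b * d)\<rbrakk>
   \<Longrightarrow> super_flip Pos D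
        \<lparr> arcs = insert {v1, v3} (arcs D - {{v0, v2}}),
          orient = insert (v3, v1) (reverse_edge v1 v2 (orient D - {(v0, v2)})),
          lam = (lam D)({v1, v3} :=
             (a * c + b * d) * (1 + \<sigma> * \<theta> * pos_sqrt Pos chi * ring_inv (1 + chi)) * ring_inv e),
          mu = (mu D)(
             {v0, v1, v3} := (\<theta> + pos_sqrt Pos chi * \<sigma>) * ring_inv (pos_sqrt Pos (1 + chi)),
             {v1, v2, v3} := (\<sigma> - pos_sqrt Pos chi * \<theta>) * ring_inv (pos_sqrt Pos (1 + chi))) \<rparr>"

text \<open>
  The \<open>\<lambda>\<close>-length of an arbitrary arc: its value in any triangulation that contains the arc and
  is obtained from the given one by flips.
\<close>

definition lambda_length ::
    "'a::real_algebra_1 set \<Rightarrow> 'a decoration \<Rightarrow> nat \<Rightarrow> nat \<Rightarrow> 'a" where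
  "lambda_length Pos D i j =
     (THE x. \<exists>D'. (super_flip Pos)\<^sup>*\<^sup>* D D' \<and> {i, j} \<in> arcs D' \<and> x = lam D' {i, j})"

section \<open>The connection\<close>

definition E_mat :: "'a::real_algebra_1 \<Rightarrow> 'a^3^3" where
  "E_mat x = vector [vector [0, - x, 0],
                     vector [ring_inv x, 0, 0],
                     vector [0, 0, 1]]"

definition A_mat :: "'a::real_algebra_1 set \<Rightarrow> 'a \<Rightarrow> 'a \<Rightarrow> 'a^3^3" where
  "A_mat Pos h \<theta> = vector [vector [1, 0, 0],
                           vector [h, 1, - (pos_sqrt Pos h * \<theta>)],
                           vector [pos_sqrt Pos h * \<theta>, 0, 1]]"

definition rho_mat :: "'a::real_algebra_1^3^3" where
  "rho_mat = vector [vector [- 1, 0, 0],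
                     vector [0, - 1, 0],
                     vector [0, 0, 1]]"

definition h_length :: "'a::real_algebra_1 decoration \<Rightarrow> nat \<Rightarrow> nat \<Rightarrow> nat \<Rightarrow> 'a" where
  "h_length D i j k = lam D {j, k} * ring_inv (lam D {i, j} * lam D {i, k})"

text \<open>
  The triple \<open>(i, j, k)\<close> stands for the vertex of \<open>\<Gamma>\<^sub>T\<close> in the triangle \<open>ijk\<close> at the corner \<open>i\<close>,
  at the end of the hexagon edge parallel to the side \<open>ij\<close>.  The six orderings of a triangle
  give the six vertices of its hexagon.  The endpoints of the hexagon edge at the angle \<open>i\<close> are
  \<open>(i, j, k)\<close> and \<open>(i, k, j)\<close>, and those of the edge parallel to \<open>ij\<close> are \<open>(i, j, k)\<close> and
  \<open>(j, i, k)\<close>.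
\<close>

type_synonym gvertex = "nat \<times> nat \<times> nat"

definition near :: "nat set set \<Rightarrow> nat \<Rightarrow> gvertex \<Rightarrow> bool" where
  "near T i u \<longleftrightarrow> (\<exists>j k. {i, j, k} \<in> triangles T \<and> u = (i, j, k))"

text \<open>
  \<open>connection Pos D u v M\<close> lists each edge of \<open>\<Gamma>\<^sub>T\<close> with the matrix \<open>M\<close> of its orientation from
  \<open>u\<close> to \<open>v\<close>: edges of a hexagon appear with their clockwise orientation, edges crossing a
  diagonal with both (the two matrices concerned are their own inverses).  Going clockwise around
  the hexagon of a triangle with \<open>cw i j k\<close>, one meets \<open>(i, k, j), (i, j, k), (j, i, k)\<close>.
\<close>

inductive connection ::
    "'a::real_algebra_1 set \<Rightarrow> 'a decoration \<Rightarrow> gvertex \<Rightarrow> gvertex \<Rightarrow> 'a^3^3 \<Rightarrow> bool"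
  for Pos :: "'a set" and D :: "'a decoration" where
  angle: "\<lbrakk>{i, j, k} \<in> triangles (arcs D); cw i j k\<rbrakk> \<Longrightarrow>
    connection Pos D (i, k, j) (i, j, k) (A_mat Pos (h_length D i j k) (mu D {i, j, k}))"
| side: "\<lbrakk>{i, j, k} \<in> triangles (arcs D); cw i j k\<rbrakk> \<Longrightarrow>
    connection Pos D (i, j, k) (j, i, k) (E_mat (lam D {i, j}))"
| cross_tail: "\<lbrakk>{i, j, k} \<in> triangles (arcs D); {i, j, l} \<in> triangles (arcs D); k \<noteq> l;
    (i, j) \<in> orient D\<rbrakk> \<Longrightarrow>
    connection Pos D (i, j, k) (i, j, l) (mat 1)"
| cross_head: "\<lbrakk>{i, j, k} \<in> triangles (arcs D); {i, j, l} \<in> triangles (arcs D); k \<noteq> l;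
    (i, j) \<in> orient D\<rbrakk> \<Longrightarrow>
    connection Pos D (j, i, k) (j, i, l) rho_mat"

text \<open>\<open>holonomy Pos D u v H\<close>: some path in \<open>\<Gamma>\<^sub>T\<close> from \<open>u\<close> to \<open>v\<close> has holonomy \<open>H\<close>.\<close>

inductive holonomy ::
    "'a::real_algebra_1 set \<Rightarrow> 'a decoration \<Rightarrow> gvertex \<Rightarrow> gvertex \<Rightarrow> 'a^3^3 \<Rightarrow> bool"
  for Pos :: "'a set" and D :: "'a decoration" and u :: gvertex where
  refl: "holonomy Pos D u u (mat 1)"
| forward: "\<lbrakk>holonomy Pos D u v H; connection Pos D v w M\<rbrakk> \<Longrightarrow> holonomy Pos D u w (M ** H)"
| backward: "\<lbrakk>holonomy Pos D u v H; connection Pos D w v M\<rbrakk> \<Longrightarrow>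
    holonomy Pos D u w (matrix_inv M ** H)"

end

theory Submission
  imports Defs
begin

text \<open>
  The connection is flat, so it is the coboundary of a potential on the vertices of the graph, and a
  holonomy is a quotient of two values of the potential.  Near a polygon vertex the potential only
  varies by left multiplication with matrices whose first row and second column are those of the
  identity up to sign, so it provides for each polygon vertex \<open>x\<close> a matrix \<open>P x\<close>, and the (1,2)-entry
  of a holonomy from near \<open>i\<close> to near \<open>j\<close> is, up to sign, that of \<open>P j (P i)\<^sup>-\<^sup>1\<close>.  By the super
  Ptolemy relations a flip changes the potential only inside the quadrilateral, and \<open>P\<close> not at all.
  After flipping to the fan with apex \<open>i\<close>, the arc \<open>ij\<close> is an edge and the entry is read off from
  \<open>E_mat\<close>.  This holds for every sequence of flips reaching a triangulation that contains \<open>ij\<close>, since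
  such a triangulation can be flipped further to the fan at \<open>i\<close> without touching \<open>ij\<close>.  As positive
  elements are determined by their value up to sign, the \<open>\<lambda>\<close>-length is also independent of the
  flips.
\<close>

section \<open>Super-commutative algebra\<close>

text \<open>A potential on an arbitrary triangulation would call for an induction over its dual
  tree, whereas on a fan it is an explicit recursion around the apex. It is therefore built only at
  the end of a sequence of flips and pulled back to the start; no flip ever has to be inverted as a
  transformation of decorations. Signs are the delicate point. Two of the relations between old and
  new angles contain a negated odd parameter. Such a minus sign is a conjugation by
  \<open>rho_mat\<close>, and the reversal of \<open>v1v2\<close> together with the crossing
  matrices of the two diagonals supplies exactly the factors required. Signs that remain near a
  polygon vertex can only affect the diagonal entries of horocyclic matrices, hence the sign of the
  (1,2)-entry. As \<open>lambda_length\<close> is a definite description over all sequences of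
  flips, its consistency is part of the proof. The given holonomy does not depend on any flip and
  serves as the common term of comparison.\<close>

text \<open>
  The substitution \<open>p = \<surd>h \<theta>\<close> turns products of the matrices \<open>A_mat\<close> into an addition law that holds
  without any commutation hypothesis.
\<close>

definition B_mat :: "'a::real_algebra_1 \<Rightarrow> 'a \<Rightarrow> 'a^3^3" where
  "B_mat x p = vector [vector [1, 0, 0], vector [x, 1, - p], vector [p, 0, 1]]"

lemma A_mat_eq: "A_mat Pos h t = B_mat h (pos_sqrt Pos h * t)"
  by (simp add: A_mat_def B_mat_def)

lemmas mat3 = vec_eq_iff forall_3 matrix_matrix_mult_def sum_3 mat_def

lemma B_mat_mult: "B_mat x p ** B_mat y q = B_mat (x + y - p * q) (p + q)"
  by (simp add: B_mat_def mat3)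

lemma B_mat_zero: "B_mat 0 0 = mat 1"
  by (simp add: B_mat_def mat3)

lemma rho_mult_rho: "rho_mat ** rho_mat = (mat 1 :: 'a::real_algebra_1^3^3)"
  by (simp add: rho_mat_def mat3)

text \<open>Conjugation by \<open>rho_mat\<close> reverses the odd parameter; this absorbs the minus
  signs in the flip relations between angles.\<close>

lemma rho_conj_B: "rho_mat ** B_mat x p ** rho_mat = B_mat x (- p)"
  by (simp add: B_mat_def rho_mat_def mat3)

lemma rho_E: "rho_mat ** E_mat x = E_mat x ** rho_mat"
  by (simp add: E_mat_def rho_mat_def mat3)

context positive_superalgebra
begin

section \<open>Inverses, square roots and normal forms of products\<close>

lemma Ev_left_commute: "x \<in> Ev \<Longrightarrow> y * (x * z) = x * (y * z)"
  by (metis Ev_central mult.assoc)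

lemma Ev_mult_mult: "y \<in> Ev \<Longrightarrow> (x * y) * (z * w) = (x * z) * (y * w)"
  by (simp add: mult.assoc Ev_left_commute)

lemma Pos_imp_Ev: "x \<in> Pos \<Longrightarrow> x \<in> Ev"
  using Pos_Ev by blast

lemma Pos_inv_unique:
  assumes "x \<in> Pos" "y \<in> Pos" "x * y = 1"
  shows "ring_inv x = y"
  unfolding ring_inv_def
proof (rule the_equality)
  show "x * y = 1 \<and> y * x = 1" using assms Ev_central Pos_imp_Ev by metis
  fix z assume "x * z = 1 \<and> z * x = 1"
  then show "z = y" using assms by (metis mult.assoc mult_1 mult_1_right)
qed

lemma Pos_ring_inv [simp, intro]: "x \<in> Pos \<Longrightarrow> ring_inv x \<in> Pos"
  using Pos_inv_unique Pos_inverse by metis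

lemma ring_inv_right: "x \<in> Pos \<Longrightarrow> x * ring_inv x = 1"
  using Pos_inv_unique Pos_inverse by metis

lemma ring_inv_left: "x \<in> Pos \<Longrightarrow> ring_inv x * x = 1"
  using ring_inv_right Ev_central Pos_imp_Ev by metis

lemma ring_inv_mult: "x \<in> Pos \<Longrightarrow> y \<in> Pos \<Longrightarrow> ring_inv (x * y) = ring_inv x * ring_inv y"
  by (rule Pos_inv_unique)
     (simp_all add: Pos_mult Ev_mult_mult [of y x "ring_inv x" "ring_inv y"] Pos_imp_Ev ring_inv_right)

lemma pos_sqrt_unique: "y \<in> Pos \<Longrightarrow> y * y = x \<Longrightarrow> pos_sqrt Pos x = y"
  unfolding pos_sqrt_def by (rule the1_equality [OF Pos_sqrt]) (auto intro: Pos_mult)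

lemma Pos_pos_sqrt [simp, intro]: "x \<in> Pos \<Longrightarrow> pos_sqrt Pos x \<in> Pos"
  using Pos_sqrt pos_sqrt_unique by metis

lemma pos_sqrt_square: "x \<in> Pos \<Longrightarrow> pos_sqrt Pos x * pos_sqrt Pos x = x"
  using Pos_sqrt pos_sqrt_unique by metis

lemma pos_sqrt_mult: "x \<in> Pos \<Longrightarrow> y \<in> Pos \<Longrightarrow> pos_sqrt Pos (x * y) = pos_sqrt Pos x * pos_sqrt Pos y"
  by (rule pos_sqrt_unique)
     (simp_all add: Pos_mult Pos_imp_Ev pos_sqrt_square
        Ev_mult_mult [of "pos_sqrt Pos y" "pos_sqrt Pos x" "pos_sqrt Pos x" "pos_sqrt Pos y"])

lemma pos_sqrt_ring_inv: "x \<in> Pos \<Longrightarrow> pos_sqrt Pos (ring_inv x) = ring_inv (pos_sqrt Pos x)"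
  by (rule pos_sqrt_unique)
     (simp_all add: ring_inv_mult [symmetric] pos_sqrt_square)

lemma zero_notin_Pos: "0 \<notin> Pos"
  using Pos_inverse by fastforce

lemma Od_square: "x \<in> Od \<Longrightarrow> x * x = 0"
proof -
  assume "x \<in> Od"
  then have "x * x = - (x * x)" by (intro Od_anticommute)
  then have "2 *\<^sub>R (x * x) = 0" by (metis add.right_inverse scaleR_2)
  then show ?thesis by simp
qed

lemma Od_add: "x \<in> Od \<Longrightarrow> y \<in> Od \<Longrightarrow> x + y \<in> Od"
  and Od_diff: "x \<in> Od \<Longrightarrow> y \<in> Od \<Longrightarrow> x - y \<in> Od"
  using subspace_Od by (auto simp: subspace_add subspace_diff)

lemma Pos_Od: "x \<in> Pos \<Longrightarrow> y \<in> Od \<Longrightarrow> x * y \<in> Od"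
  using Ev_Od Pos_imp_Ev by blast

lemma Od_Pos: "x \<in> Pos \<Longrightarrow> y \<in> Od \<Longrightarrow> y * x \<in> Od"
  using Pos_Od Ev_central Pos_imp_Ev by metis

lemma Pos_cancel: "x \<in> Pos \<Longrightarrow> x * y = x * z \<Longrightarrow> y = z"
  by (metis mult.assoc mult_1 ring_inv_left)

lemma ring_inv_cancel: "x \<in> Pos \<Longrightarrow> x * (ring_inv x * z) = z" "x \<in> Pos \<Longrightarrow> ring_inv x * (x * z) = z"
  by (simp_all flip: mult.assoc add: ring_inv_left ring_inv_right)

lemma Pos_mult_comm: "x \<in> Pos \<Longrightarrow> x * y = y * x" "y \<in> Pos \<Longrightarrow> x * y = y * x"
  using Ev_central Pos_imp_Ev by metis+

lemma Pos_mult_left_comm: "x \<in> Pos \<Longrightarrow> x * (y * z) = y * (x * z)" "y \<in> Pos \<Longrightarrow> x * (y * z) = y * (x * z)"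
  using Ev_left_commute Pos_imp_Ev by metis+

text \<open>Ordered rewriting in which only positive factors move, so that odd factors keep their
  relative order.\<close>

lemmas Pos_ac = mult.assoc Pos_mult_comm Pos_mult_left_comm

text \<open>Complements \<open>Pos_ac\<close> for two odd elements: \<open>si\<close> moves to the
  left of \<open>th\<close> at the cost of a sign, and squares vanish.\<close>

lemma Od_mult_rules:
  assumes "si \<in> Od" "th \<in> Od"
  shows "th * th = 0" "si * si = 0" "th * (th * z) = 0" "si * (si * z) = 0"
    "th * si = - (si * th)" "th * (si * z) = - (si * (th * z))"
proof -
  show "th * th = 0" "si * si = 0" "th * si = - (si * th)"
    using assms Od_square Od_anticommute by blast+
  then show "th * (th * z) = 0" "si * (si * z) = 0" "th * (si * z) = - (si * (th * z))"
    by (simp_all flip: mult.assoc)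
qed

lemma A_mat_mult:
  assumes "h = h1 + h2 - pos_sqrt Pos h1 * t1 * (pos_sqrt Pos h2 * t2)"
    and "pos_sqrt Pos h * t = pos_sqrt Pos h1 * t1 + pos_sqrt Pos h2 * t2"
  shows "A_mat Pos h t = A_mat Pos h1 t1 ** A_mat Pos h2 t2"
  by (simp only: A_mat_eq B_mat_mult assms(2) assms(1) [symmetric])

section \<open>The super Ptolemy relations\<close>

text \<open>The right-hand sides of \<open>super_flip\<close> as functions of the initial values.
  \<open>ptolemy_mu1\<close> belongs to the new triangle at the tail \<open>v0\<close>,
  \<open>ptolemy_mu2\<close> to the one at the head \<open>v2\<close>.\<close>

definition ptolemy_ratio where
  "ptolemy_ratio a b c d = a * c * ring_inv (b * d)"

definition ptolemy_lam where
  "ptolemy_lam a b c d e th si =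
     (a * c + b * d) * (1 + si * th * pos_sqrt Pos (ptolemy_ratio a b c d)
        * ring_inv (1 + ptolemy_ratio a b c d)) * ring_inv e"

definition ptolemy_mu1 where
  "ptolemy_mu1 a b c d th si =
     (th + pos_sqrt Pos (ptolemy_ratio a b c d) * si) * ring_inv (pos_sqrt Pos (1 + ptolemy_ratio a b c d))"

definition ptolemy_mu2 where
  "ptolemy_mu2 a b c d th si =
     (si - pos_sqrt Pos (ptolemy_ratio a b c d) * th) * ring_inv (pos_sqrt Pos (1 + ptolemy_ratio a b c d))"

context
  fixes a b c d e th si
  assumes abcde: "a \<in> Pos" "b \<in> Pos" "c \<in> Pos" "d \<in> Pos" "e \<in> Pos"
    and odd: "th \<in> Od" "si \<in> Od"
begin

private abbreviation "f \<equiv> ptolemy_lam a b c d e th si"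
private abbreviation "th' \<equiv> ptolemy_mu1 a b c d th si"
private abbreviation "si' \<equiv> ptolemy_mu2 a b c d th si"
private abbreviation "rt \<equiv> pos_sqrt Pos"

lemma chi_Pos: "ptolemy_ratio a b c d \<in> Pos"
  unfolding ptolemy_ratio_def by (intro Pos_mult Pos_ring_inv abcde)

lemma one_chi_Pos: "1 + ptolemy_ratio a b c d \<in> Pos"
  by (intro Pos_add one_Pos chi_Pos)

lemma chi_bd: "b * d * ptolemy_ratio a b c d = a * c"
  unfolding ptolemy_ratio_def using abcde
  by (metis Pos_mult Pos_mult_comm(1) Pos_ring_inv mult.assoc mult_1_right ring_inv_left)

lemma one_chi_bd: "b * d * (1 + ptolemy_ratio a b c d) = a * c + b * d"
  by (simp add: distrib_left chi_bd)

lemma rt_chi: "rt b * (rt d * rt (ptolemy_ratio a b c d)) = rt a * rt c"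
  using arg_cong[OF chi_bd, of rt] abcde chi_Pos
  by (simp add: pos_sqrt_mult Pos_mult mult.assoc)

lemma rt_one_chi: "rt b * (rt d * rt (1 + ptolemy_ratio a b c d)) = rt (a * c + b * d)"
  using arg_cong[OF one_chi_bd, of rt] abcde one_chi_Pos
  by (simp add: pos_sqrt_mult Pos_mult mult.assoc)

lemma ptolemy_mu_Od: "th' \<in> Od" "si' \<in> Od"
  unfolding ptolemy_mu1_def ptolemy_mu2_def
  by (intro Od_Pos Od_add Od_diff Pos_Od odd Pos_ring_inv Pos_pos_sqrt chi_Pos one_chi_Pos)+

text \<open>The factor \<open>v\<close> is the square root of the nilpotent correction in
  \<open>e * f\<close>. It differs from 1 by a multiple of \<open>si * th\<close>, so it fixes both
  odd invariants. Hence the square root of \<open>e * f\<close> acts on them like that of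
  \<open>a * c + b * d\<close>.\<close>

lemma sqrt_ptolemy_lam:
  obtains v where "f \<in> Pos" "rt e * rt f = rt (a * c + b * d) * v" "v * th = th" "v * si = si"
proof -
  define x where "x = rt (ptolemy_ratio a b c d)"
  define y where "y = ring_inv (1 + ptolemy_ratio a b c d)"
  have xy: "x \<in> Pos" "y \<in> Pos" unfolding x_def y_def using chi_Pos one_chi_Pos by auto
  define t where "t = th * x * y"
  have t: "t \<in> Od" unfolding t_def by (intro Od_Pos xy odd)
  then have t2: "(1/2) *\<^sub>R t \<in> Od" using subspace_Od by (simp add: subspace_mul)
  define v where "v = 1 + si * ((1/2) *\<^sub>R t)"
  have v: "v \<in> Pos" unfolding v_def by (intro Pos_add_Od_Od one_Pos odd t2)
  note rules = Od_mult_rules[OF odd(2,1)] Pos_ac xy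
  \<comment> \<open>As \<open>(si t)\<^sup>2 = 0\<close>, the square root of \<open>1 + si t\<close> is \<open>1 + si t / 2\<close>.\<close>
  have st: "si * t * (si * t) = 0" unfolding t_def by (simp add: rules)
  have vv: "v * v = 1 + si * t"
    unfolding v_def by (simp add: algebra_simps st [unfolded mult.assoc] flip: scaleR_2 scaleR_add_left)
  have w: "1 + si * t \<in> Pos" by (intro Pos_add_Od_Od one_Pos odd t)
  then have sw: "rt (1 + si * t) = v" using v vv pos_sqrt_unique by blast
  have m: "a * c + b * d \<in> Pos" by (intro Pos_add Pos_mult abcde)
  have f: "f = (a * c + b * d) * (1 + si * t) * ring_inv e"
    unfolding ptolemy_lam_def t_def x_def y_def by (simp add: mult.assoc)
  then have 1: "f \<in> Pos" using m w abcde by (auto intro!: Pos_mult)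
  have "e * f = (a * c + b * d) * (1 + si * t)"
    unfolding f using abcde w m by (metis Pos_mult_comm(1) Pos_mult mult.assoc mult_1_right ring_inv_left)
  from arg_cong[OF this, of rt] have 2: "rt e * rt f = rt (a * c + b * d) * v"
    using m w abcde 1 by (simp add: pos_sqrt_mult sw)
  have 3: "v * th = th" "v * si = si"
    unfolding v_def t_def by (simp_all add: distrib_right rules)
  show thesis
    using that[OF 1 2 3] .
qed

lemma ptolemy_lam_Pos: "f \<in> Pos"
  using sqrt_ptolemy_lam by blast

lemma ptolemy_lam_mult_th: "rt e * rt f * th = rt (a * c + b * d) * th"
  and ptolemy_lam_mult_si: "rt e * rt f * si = rt (a * c + b * d) * si"
  using sqrt_ptolemy_lam by (metis mult.assoc)+

text \<open>Form without denominators: \<open>1 + chi\<close> cancels against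
  \<open>a * c + b * d = b * d * (1 + chi)\<close>, and \<open>b * d\<close> times the root of
  \<open>chi\<close> is the product of the four square roots. The final sign comes from exchanging
  \<open>si\<close> and \<open>th\<close>.\<close>

lemma ptolemy_lam_eq: "e * f = a * c + b * d - rt a * rt b * rt c * rt d * (th * si)"
proof -
  define x where "x = rt (ptolemy_ratio a b c d)"
  have x: "x \<in> Pos" unfolding x_def using chi_Pos by auto
  have bd: "b * d * x = rt a * rt b * rt c * rt d"
  proof -
    have "b * d * x = rt b * rt d * (rt b * (rt d * x))"
      using pos_sqrt_square[of b] pos_sqrt_square[of d] abcde x
      by (metis Ev_mult_mult Pos_imp_Ev Pos_pos_sqrt mult.assoc)
    also have "\<dots> = rt b * rt d * (rt a * rt c)"
      by (simp add: rt_chi x_def)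
    finally show ?thesis using abcde by (simp add: Pos_ac)
  qed
  have o: "1 + ptolemy_ratio a b c d \<in> Pos" by (rule one_chi_Pos)
  have w: "1 + si * th * x * ring_inv (1 + ptolemy_ratio a b c d) \<in> Pos"
    using Pos_add_Od_Od[OF one_Pos odd(2) Od_Pos[OF Pos_mult[OF x Pos_ring_inv[OF o]] odd(1)]]
    by (simp add: mult.assoc)
  have m: "a * c + b * d \<in> Pos" by (intro Pos_add Pos_mult abcde)
  have "e * f = (a * c + b * d) * (1 + si * th * x * ring_inv (1 + ptolemy_ratio a b c d))"
    unfolding ptolemy_lam_def x_def[symmetric] using abcde w m
    by (metis Pos_mult_comm(1) Pos_mult mult.assoc mult_1_right ring_inv_left)
  also have "\<dots> = (a * c + b * d) + b * d * x * (si * th)"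
  proof -
    have "(a * c + b * d) * (si * th * x * ring_inv (1 + ptolemy_ratio a b c d))
      = (b * d * (1 + ptolemy_ratio a b c d)) * (ring_inv (1 + ptolemy_ratio a b c d) * (x * (si * th)))"
      unfolding one_chi_bd using x o by (simp add: Pos_ac)
    also have "\<dots> = b * d * x * (si * th)"
      using o by (simp add: mult.assoc ring_inv_cancel)
    finally show ?thesis by (simp only: distrib_left mult_1_right)
  qed
  finally show ?thesis unfolding bd using Od_anticommute[OF odd] by simp
qed

text \<open>On odd elements the root of \<open>e * f\<close> acts as the root of
  \<open>a * c + b * d\<close>, which contains the denominator of \<open>th'\<close> as a
  factor.\<close>

lemma ptolemy_mu1_eq: "rt e * rt f * th' = rt b * rt d * th + rt a * rt c * si"
proof -
  define x where "x = rt (ptolemy_ratio a b c d)"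
  define s where "s = rt (1 + ptolemy_ratio a b c d)"
  have xs: "x \<in> Pos" "s \<in> Pos" unfolding x_def s_def using chi_Pos one_chi_Pos by auto
  have "rt e * rt f * th' = rt e * rt f * th * ring_inv s + x * (rt e * rt f * si) * ring_inv s"
    unfolding ptolemy_mu1_def using xs ptolemy_lam_Pos abcde
    by (simp add: Pos_ac distrib_left distrib_right flip: x_def s_def)
  also have "\<dots> = rt b * rt d * (s * ring_inv s) * th + rt b * (rt d * x) * (s * ring_inv s) * si"
    unfolding ptolemy_lam_mult_th ptolemy_lam_mult_si rt_one_chi [symmetric] s_def [symmetric] using xs abcde
    by (simp add: Pos_ac)
  finally show ?thesis using rt_chi xs by (simp add: ring_inv_right x_def)
qed

lemma ptolemy_mu2_eq: "rt e * rt f * si' = rt b * rt d * si - rt a * rt c * th"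
proof -
  define x where "x = rt (ptolemy_ratio a b c d)"
  define s where "s = rt (1 + ptolemy_ratio a b c d)"
  have xs: "x \<in> Pos" "s \<in> Pos" unfolding x_def s_def using chi_Pos one_chi_Pos by auto
  have "rt e * rt f * si' = rt e * rt f * si * ring_inv s - x * (rt e * rt f * th) * ring_inv s"
    unfolding ptolemy_mu2_def using xs ptolemy_lam_Pos abcde
    by (simp add: Pos_ac right_diff_distrib left_diff_distrib flip: x_def s_def)
  also have "\<dots> = rt b * rt d * (s * ring_inv s) * si - rt b * (rt d * x) * (s * ring_inv s) * th"
    unfolding ptolemy_lam_mult_th ptolemy_lam_mult_si rt_one_chi [symmetric] s_def [symmetric] using xs abcde
    by (simp add: Pos_ac)
  finally show ?thesis using rt_chi xs by (simp add: ring_inv_right x_def)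
qed

text \<open>The correction term of \<open>e * f\<close> contains both odd invariants, so multiplying
  by either of them annihilates it.\<close>

lemma ptolemy_lam_mu: "e * (f * th) = (a * c + b * d) * th" "e * (f * si) = (a * c + b * d) * si"
  using abcde ptolemy_lam_eq
  by (simp_all flip: mult.assoc) (simp_all add: distrib_right left_diff_distrib Od_mult_rules[OF odd(2,1)] Pos_ac)

lemma pos_sqrt_mult_self: "x \<in> Pos \<Longrightarrow> rt x * (rt x * z) = x * z"
  by (simp flip: mult.assoc add: pos_sqrt_square)

text \<open>
  These are the relations of the inverse flip.
\<close>

lemma ptolemy_inverse_mu:
  "rt e * rt f * th = rt b * rt d * th' - rt a * rt c * si'" (is ?A)
  "rt e * rt f * si = rt a * rt c * th' + rt b * rt d * si'" (is ?B)
proof -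
  note mus = ptolemy_mu1_eq ptolemy_mu2_eq
  have ef: "rt e * rt f \<in> Pos" using ptolemy_lam_Pos abcde by (auto intro: Pos_mult)
  \<comment> \<open>Up to scaling, the passage from \<open>th\<close>, \<open>si\<close> to
    \<open>th'\<close>, \<open>si'\<close> is a rotation. Applying the transpose cancels the mixed
    terms and leaves the factor \<open>a * c + b * d\<close>.\<close>
  have "rt e * rt f * (rt b * rt d * th' - rt a * rt c * si')
     = rt b * rt d * (rt e * rt f * th') - rt a * rt c * (rt e * rt f * si')"
    using abcde ptolemy_lam_Pos by (simp add: Pos_ac right_diff_distrib)
  also have "\<dots> = (a * c + b * d) * th"
    unfolding mus using abcde by (simp add: algebra_simps Pos_ac pos_sqrt_mult_self pos_sqrt_square)
  also have "\<dots> = rt e * rt f * (rt e * rt f * th)"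
    unfolding ptolemy_lam_mu [symmetric]
    using abcde ptolemy_lam_Pos by (simp add: Pos_ac pos_sqrt_mult_self pos_sqrt_square)
  finally show ?A using Pos_cancel [OF ef] by metis
  have "rt e * rt f * (rt a * rt c * th' + rt b * rt d * si')
     = rt a * rt c * (rt e * rt f * th') + rt b * rt d * (rt e * rt f * si')"
    using abcde ptolemy_lam_Pos by (simp add: Pos_ac distrib_left)
  also have "\<dots> = (a * c + b * d) * si"
    unfolding mus using abcde by (simp add: algebra_simps Pos_ac pos_sqrt_mult_self pos_sqrt_square)
  also have "\<dots> = rt e * rt f * (rt e * rt f * si)"
    unfolding ptolemy_lam_mu [symmetric]
    using abcde ptolemy_lam_Pos by (simp add: Pos_ac pos_sqrt_mult_self pos_sqrt_square)
  finally show ?B using Pos_cancel [OF ef] by metis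
qed

text \<open>A product of two anticommuting elements is multiplied by the determinant of a linear
  substitution. Here this is \<open>a * c + b * d\<close>, which agrees with \<open>e * f\<close> on
  odd invariants. The correction term in the Ptolemy relation is thus the same for both
  diagonals.\<close>

lemma ptolemy_mu_mult: "th' * si' = th * si"
proof (rule Pos_cancel)
  note mus = ptolemy_mu1_eq ptolemy_mu2_eq
  show ef: "e * f \<in> Pos" using ptolemy_lam_Pos abcde by (auto intro: Pos_mult)
  have "e * f * (th' * si') = (rt e * rt f * th') * (rt e * rt f * si')"
    using abcde ptolemy_lam_Pos by (simp add: Pos_ac pos_sqrt_mult_self pos_sqrt_square)
  also have "\<dots> = (a * c + b * d) * th * si"
    unfolding mus using abcde by (simp add: algebra_simps Pos_ac pos_sqrt_mult_self pos_sqrt_square Od_mult_rules[OF odd(2,1)])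
  also have "\<dots> = e * f * (th * si)"
    unfolding ptolemy_lam_mu(1) [symmetric] by (simp add: mult.assoc)
  finally show "e * f * (th' * si') = e * f * (th * si)" .
qed

end

section \<open>Relations between angle and side matrices\<close>

lemma sqrt_h: "p \<in> Pos \<Longrightarrow> x \<in> Pos \<Longrightarrow> y \<in> Pos \<Longrightarrow>
   pos_sqrt Pos (p * ring_inv (x * y)) = pos_sqrt Pos p * (ring_inv (pos_sqrt Pos x) * ring_inv (pos_sqrt Pos y))"
  by (simp add: pos_sqrt_mult Pos_mult ring_inv_mult pos_sqrt_ring_inv)

text \<open>Adjacent angles at one vertex: \<open>x\<close>, \<open>y\<close>, \<open>z\<close> are
  the lengths of consecutive arcs leaving it, \<open>q\<close> and \<open>r\<close> those of the
  sides opposite to the two small angles, and \<open>p\<close> that of the side opposite to their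
  union. The diagonals of the quadrilateral are \<open>y\<close> and \<open>p\<close>.\<close>

lemma A_mat_combine:
  assumes P: "x \<in> Pos" "y \<in> Pos" "z \<in> Pos" "p \<in> Pos" "q \<in> Pos" "r \<in> Pos"
    and e: "y * p = z * q + x * r - pos_sqrt Pos x * pos_sqrt Pos z * pos_sqrt Pos q * pos_sqrt Pos r * (t1 * t2)"
    and o: "pos_sqrt Pos y * pos_sqrt Pos p * t = pos_sqrt Pos z * pos_sqrt Pos q * t1 + pos_sqrt Pos x * pos_sqrt Pos r * t2"
  shows "A_mat Pos (p * ring_inv (x * z)) t
     = A_mat Pos (q * ring_inv (x * y)) t1 ** A_mat Pos (r * ring_inv (y * z)) t2"
proof (rule A_mat_mult)
  \<comment> \<open>Everything becomes a monomial in square roots and their inverses, so that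
    cancellation is plain rewriting with \<open>c\<close>.\<close>
  define x1 x2 where "x1 = pos_sqrt Pos x" and "x2 = ring_inv (pos_sqrt Pos x)"
  define y1 y2 where "y1 = pos_sqrt Pos y" and "y2 = ring_inv (pos_sqrt Pos y)"
  define z1 z2 where "z1 = pos_sqrt Pos z" and "z2 = ring_inv (pos_sqrt Pos z)"
  define p1 q1 r1 where "p1 = pos_sqrt Pos p" and "q1 = pos_sqrt Pos q" and "r1 = pos_sqrt Pos r"
  note d = x1_def y1_def z1_def x2_def y2_def z2_def p1_def q1_def r1_def
  have P1: "x1 \<in> Pos" "x2 \<in> Pos" "y1 \<in> Pos" "y2 \<in> Pos" "z1 \<in> Pos" "z2 \<in> Pos"
     "p1 \<in> Pos" "q1 \<in> Pos" "r1 \<in> Pos"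
    unfolding d using P by auto
  have sq: "x = x1 * x1" "y = y1 * y1" "z = z1 * z1" "p = p1 * p1" "q = q1 * q1" "r = r1 * r1"
    unfolding d using P by (simp_all add: pos_sqrt_square)
  have inv: "ring_inv x1 = x2" "ring_inv y1 = y2" "ring_inv z1 = z2"
    unfolding d by simp_all
  have c: "x1 * x2 = 1" "y1 * y2 = 1" "z1 * z2 = 1"
    "\<And>u. x1 * (x2 * u) = u" "\<And>u. y1 * (y2 * u) = u" "\<And>u. z1 * (z2 * u) = u"
    unfolding d using P by (simp_all add: ring_inv_right ring_inv_cancel)
  have rts: "pos_sqrt Pos x = x1" "pos_sqrt Pos y = y1" "pos_sqrt Pos z = z1"
     "pos_sqrt Pos p = p1" "pos_sqrt Pos q = q1" "pos_sqrt Pos r = r1" by (simp_all add: d)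
  have sh: "pos_sqrt Pos (p * ring_inv (x * z)) = p1 * (x2 * z2)"
     "pos_sqrt Pos (q * ring_inv (x * y)) = q1 * (x2 * y2)"
     "pos_sqrt Pos (r * ring_inv (y * z)) = r1 * (y2 * z2)"
    using P by (simp_all add: sqrt_h rts inv)
  have hh: "ring_inv (x * z) = x2 * (x2 * (z2 * z2))"
    "ring_inv (x * y) = x2 * (x2 * (y2 * y2))" "ring_inv (y * z) = y2 * (y2 * (z2 * z2))"
    using P1 by (simp_all add: sq ring_inv_mult Pos_mult inv mult.assoc)
  note e' = e [unfolded rts, unfolded sq] and o' = o [unfolded rts]
  show "p * ring_inv (x * z) = q * ring_inv (x * y) + r * ring_inv (y * z) -
    pos_sqrt Pos (q * ring_inv (x * y)) * t1 * (pos_sqrt Pos (r * ring_inv (y * z)) * t2)"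
  proof -
    \<comment> \<open>The h-length is written as \<open>y * p\<close> divided by
      \<open>x * y * z\<close>, which makes the Ptolemy relation \<open>e'\<close>
      applicable.\<close>
    have "p1 * p1 * (x2 * (x2 * (z2 * z2))) = x2 * (x2 * (y2 * (y2 * (z2 * (z2 * (y1 * y1 * (p1 * p1)))))))"
      using P1 by (simp add: Pos_ac c)
    also have "\<dots> = q1 * q1 * (x2 * (x2 * (y2 * y2))) + r1 * r1 * (y2 * (y2 * (z2 * z2)))
       - q1 * (x2 * y2) * t1 * (r1 * (y2 * z2) * t2)"
      unfolding e' using P1 by (simp add: algebra_simps Pos_ac c)
    finally show ?thesis unfolding sh unfolding hh unfolding sq .
  qed
  show "pos_sqrt Pos (p * ring_inv (x * z)) * t =
    pos_sqrt Pos (q * ring_inv (x * y)) * t1 + pos_sqrt Pos (r * ring_inv (y * z)) * t2"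
  proof -
    have "p1 * (x2 * z2) * t = x2 * (y2 * (z2 * (y1 * p1 * t)))"
      using P1 by (simp add: Pos_ac c)
    also have "\<dots> = q1 * (x2 * y2) * t1 + r1 * (y2 * z2) * t2"
      unfolding o' using P1 by (simp add: algebra_simps Pos_ac c)
    finally show ?thesis unfolding sh .
  qed
qed

text \<open>Flatness on a hexagonal face. Terms quadratic in \<open>t\<close> vanish because
  \<open>t\<close> is odd, and the linear ones cancel.\<close>

lemma hexagon:
  assumes P: "x \<in> Pos" "y \<in> Pos" "z \<in> Pos" and t: "t \<in> Od"
  shows "E_mat z ** (A_mat Pos (x * ring_inv (z * y)) t ** (E_mat y ** (A_mat Pos (z * ring_inv (y * x)) t **
    (E_mat x ** A_mat Pos (y * ring_inv (x * z)) t)))) = mat 1"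
proof -
  define x1 x2 where "x1 = pos_sqrt Pos x" and "x2 = ring_inv (pos_sqrt Pos x)"
  define y1 y2 where "y1 = pos_sqrt Pos y" and "y2 = ring_inv (pos_sqrt Pos y)"
  define z1 z2 where "z1 = pos_sqrt Pos z" and "z2 = ring_inv (pos_sqrt Pos z)"
  note d = x1_def y1_def z1_def x2_def y2_def z2_def
  have P1: "x1 \<in> Pos" "x2 \<in> Pos" "y1 \<in> Pos" "y2 \<in> Pos" "z1 \<in> Pos" "z2 \<in> Pos"
    unfolding d using P by auto
  have sq: "x = x1 * x1" "y = y1 * y1" "z = z1 * z1"
    unfolding d using P by (simp_all add: pos_sqrt_square)
  have inv: "ring_inv x1 = x2" "ring_inv y1 = y2" "ring_inv z1 = z2"
    unfolding d by simp_all
  have c: "x1 * x2 = 1" "y1 * y2 = 1" "z1 * z2 = 1"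
    "\<And>u. x1 * (x2 * u) = u" "\<And>u. y1 * (y2 * u) = u" "\<And>u. z1 * (z2 * u) = u"
    unfolding d using P by (simp_all add: ring_inv_right ring_inv_cancel)
  have rts: "pos_sqrt Pos x = x1" "pos_sqrt Pos y = y1" "pos_sqrt Pos z = z1" by (simp_all add: d)
  have sh: "pos_sqrt Pos (x * ring_inv (z * y)) = x1 * (z2 * y2)"
     "pos_sqrt Pos (z * ring_inv (y * x)) = z1 * (y2 * x2)"
     "pos_sqrt Pos (y * ring_inv (x * z)) = y1 * (x2 * z2)"
    using P by (simp_all add: sqrt_h rts inv)
  have hh: "ring_inv (x * z) = x2 * (x2 * (z2 * z2))"
    "ring_inv (y * x) = x2 * (x2 * (y2 * y2))" "ring_inv (z * y) = y2 * (y2 * (z2 * z2))"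
    "ring_inv x = x2 * x2" "ring_inv y = y2 * y2" "ring_inv z = z2 * z2"
    using P1 by (simp_all add: sq ring_inv_mult Pos_mult inv Pos_ac)
  show ?thesis
    unfolding A_mat_eq sh unfolding hh E_mat_def unfolding sq
    using P1 t by (simp add: B_mat_def mat3 algebra_simps Pos_ac c Od_mult_rules(1,3) [OF t t])
qed

text \<open>
  In the notation of the definition of a flip, these are the relations between the angles of the old
  and the new triangles at \<open>v0\<close>, \<open>v1\<close>, \<open>v2\<close> and \<open>v3\<close>.
\<close>

lemma ptolemy_A_mat:
  assumes P: "a \<in> Pos" "b \<in> Pos" "c \<in> Pos" "d \<in> Pos" "e \<in> Pos"
    and odd: "th \<in> Od" "si \<in> Od"
    and f: "f = ptolemy_lam a b c d e th si"
    and th': "th' = ptolemy_mu1 a b c d th si"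
    and si': "si' = ptolemy_mu2 a b c d th si"
  shows "A_mat Pos (f * ring_inv (a * d)) th'
      = A_mat Pos (b * ring_inv (a * e)) th ** A_mat Pos (c * ring_inv (e * d)) si"
    and "A_mat Pos (e * ring_inv (b * a)) th
      = A_mat Pos (c * ring_inv (b * f)) (- si') ** A_mat Pos (d * ring_inv (f * a)) th'"
    and "A_mat Pos (f * ring_inv (c * b)) si'
      = A_mat Pos (d * ring_inv (c * e)) si ** A_mat Pos (a * ring_inv (e * b)) (- th)"
    and "A_mat Pos (e * ring_inv (d * c)) si
      = A_mat Pos (a * ring_inv (d * f)) th' ** A_mat Pos (b * ring_inv (f * c)) si'"
proof -
  have fP: "f \<in> Pos" unfolding f by (rule ptolemy_lam_Pos [OF P odd])
  have mu: "th' \<in> Od" "si' \<in> Od" unfolding th' si' by (rule ptolemy_mu_Od [OF P odd])+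
  note rules = Pos_ac P fP
  have ef: "e * f = a * c + b * d - pos_sqrt Pos a * pos_sqrt Pos b * pos_sqrt Pos c * pos_sqrt Pos d * (th * si)"
    unfolding f by (rule ptolemy_lam_eq [OF P odd])
  have anti: "si * th = - (th * si)" "si' * th' = - (th' * si')"
    by (intro Od_anticommute odd mu)+
  have mm: "th' * si' = th * si"
    unfolding th' si' by (rule ptolemy_mu_mult [OF P odd])
  note mus = ptolemy_mu1_eq [OF P odd, folded f th'] ptolemy_mu2_eq [OF P odd, folded f si']
    ptolemy_inverse_mu [OF P odd, folded f th' si']
  show "A_mat Pos (f * ring_inv (a * d)) th'
      = A_mat Pos (b * ring_inv (a * e)) th ** A_mat Pos (c * ring_inv (e * d)) si"
    by (rule A_mat_combine) (simp_all add: P fP ef mus, simp_all add: rules add_ac)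
  \<comment> \<open>At \<open>v1\<close> and \<open>v3\<close> it is the new diagonal that splits an
    old angle. The roles of \<open>e\<close> and \<open>f\<close> are exchanged, so the inverse
    relations are used, and \<open>mm\<close> identifies the two correction terms.\<close>
  show "A_mat Pos (e * ring_inv (b * a)) th
      = A_mat Pos (c * ring_inv (b * f)) (- si') ** A_mat Pos (d * ring_inv (f * a)) th'"
    by (rule A_mat_combine)
      (simp_all add: P fP Pos_mult_comm(1) [of f] Pos_mult_comm(2) [of "pos_sqrt Pos e" "pos_sqrt Pos f"] ef mus anti mm, simp_all add: rules add_ac)
  show "A_mat Pos (f * ring_inv (c * b)) si'
      = A_mat Pos (d * ring_inv (c * e)) si ** A_mat Pos (a * ring_inv (e * b)) (- th)"
    by (rule A_mat_combine) (simp_all add: P fP ef mus anti, simp_all add: rules add_ac)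
  show "A_mat Pos (e * ring_inv (d * c)) si
      = A_mat Pos (a * ring_inv (d * f)) th' ** A_mat Pos (b * ring_inv (f * c)) si'"
    by (rule A_mat_combine)
      (simp_all add: P fP Pos_mult_comm(1) [of f] Pos_mult_comm(2) [of "pos_sqrt Pos e" "pos_sqrt Pos f"] ef mus mm, simp_all add: rules add_ac)
qed

end

section \<open>Triangulations of a polygon\<close>

lemma cw_rotate: "cw i j k \<Longrightarrow> cw j k i"
  unfolding cw_def by auto

lemma cw_distinct: "cw i j k \<Longrightarrow> i \<noteq> j \<and> j \<noteq> k \<and> i \<noteq> k"
  unfolding cw_def by auto

lemma cw_asym: "cw i j k \<Longrightarrow> \<not> cw i k j"
  unfolding cw_def by auto

lemma cw_total: "i \<noteq> j \<Longrightarrow> j \<noteq> k \<Longrightarrow> i \<noteq> k \<Longrightarrow> cw i j k \<or> cw i k j"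
  unfolding cw_def by auto

lemma cw_split: "cw a b c \<Longrightarrow> cw a x c \<Longrightarrow> x = b \<or> cw a x b \<or> cw b x c"
  unfolding cw_def by auto

lemma cw_trans: "cw a b c \<Longrightarrow> cw b x c \<Longrightarrow> cw a x c \<and> cw a b x"
  unfolding cw_def by auto

lemma cw_widen: "cw a b c \<Longrightarrow> cw c y a \<Longrightarrow> cw b y a \<and> cw c y b"
  unfolding cw_def by auto

lemma triangles_iff:
  "{i, j, k} \<in> triangles T \<longleftrightarrow>
     i \<noteq> j \<and> j \<noteq> k \<and> i \<noteq> k \<and> {i, j} \<in> T \<and> {j, k} \<in> T \<and> {i, k} \<in> T" (is "?L \<longleftrightarrow> ?R")
proof
  assume ?L
  then obtain x y z where xyz: "{i, j, k} = {x, y, z}" "x \<noteq> y" "y \<noteq> z" "x \<noteq> z"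
    "{x, y} \<in> T" "{y, z} \<in> T" "{x, z} \<in> T"
    unfolding triangles_def by auto
  have "card {i, j, k} = 3" unfolding xyz(1) using xyz(2-4) by simp
  then have "i \<noteq> j" "j \<noteq> k" "i \<noteq> k"
    by (auto simp: insert_commute card_insert_if split: if_splits)
  moreover have "{u, v} \<in> T" if "u \<in> {x, y, z}" "v \<in> {x, y, z}" "u \<noteq> v" for u v
    using that xyz(5-7) by (auto simp: insert_commute)
  ultimately show ?R using xyz(1) by (metis insertI1 insertI2)
next
  assume ?R
  then show ?L unfolding triangles_def by blast
qed

lemma triangles_cases:
  assumes "t \<in> triangles T"
  obtains i j k where "t = {i, j, k}"
  using assms unfolding triangles_def by blast

lemma crossing_iff:
  "crossing {a, c} {b, d} \<longleftrightarrow> cw a b c \<and> cw c d a \<or> cw a d c \<and> cw c b a" (is "?L \<longleftrightarrow> ?R")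
proof
  assume ?L
  then show ?R unfolding crossing_def
    by (auto simp: doubleton_eq_iff)
next
  assume ?R
  then show ?L unfolding crossing_def
    by (metis insert_commute)
qed

lemma crossing_sym: "crossing e f \<Longrightarrow> crossing f e"
proof -
  assume "crossing e f"
  then obtain a b c d where "e = {c, a}" "f = {b, d}" "cw a b c" "cw c d a"
    unfolding crossing_def by (metis insert_commute)
  moreover from this have "cw b c d \<and> cw d a b"
    unfolding cw_def by auto
  ultimately show "crossing f e"
    using crossing_iff by blast
qed

section \<open>Existence and uniqueness of the triangle on a side of an arc\<close>

locale triangulated_polygon =
  fixes n :: nat and T :: "nat set set"
  assumes n_ge: "3 \<le> n" and triangulation: "triangulation n T"
begin

lemma arc_bounds: "{a, b} \<in> T \<Longrightarrow> a < n \<and> b < n \<and> a \<noteq> b"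
  using triangulation unfolding triangulation_def polygon_arcs_def
  by (auto simp: doubleton_eq_iff)

lemma arc_cases:
  assumes "e \<in> T"
  obtains a b where "e = {a, b}" "a < n" "b < n" "a \<noteq> b"
  using assms triangulation unfolding triangulation_def polygon_arcs_def by auto

lemma noncrossing: "{a, c} \<in> T \<Longrightarrow> {b, d} \<in> T \<Longrightarrow> cw a b c \<Longrightarrow> cw c d a \<Longrightarrow> False"
  using triangulation unfolding triangulation_def by (metis crossing_iff)

lemma arcI:
  assumes "a < n" "c < n" "a \<noteq> c"
    and "\<And>b d. {b, d} \<in> T \<Longrightarrow> cw a b c \<Longrightarrow> cw c d a \<Longrightarrow> False"
  shows "{a, c} \<in> T"
proof -
  have "\<not> crossing {a, c} f" if "f \<in> T" for f
    using arc_cases [OF that] assms(4) that by (metis crossing_iff insert_commute)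
  moreover have "{a, c} \<in> polygon_arcs n" using assms unfolding polygon_arcs_def by blast
  ultimately show ?thesis using triangulation unfolding triangulation_def by blast
qed

text \<open>No vertex lies strictly between \<open>x\<close> and its successor, so nothing can cross
  this arc and maximality applies.\<close>

lemma side_arc: "x < n \<Longrightarrow> {x, Suc x mod n} \<in> T"
proof (rule arcI)
  assume x: "x < n"
  show "Suc x mod n < n" using n_ge by simp
  show "x \<noteq> Suc x mod n" using x n_ge by (cases "Suc x = n") auto
  fix b d assume "{b, d} \<in> T" "cw x b (Suc x mod n)"
  then show False using x arc_bounds [of b d] unfolding cw_def
    by (cases "Suc x = n") auto
qed assumption

text \<open>Two different apexes on the same side give crossing arcs: in the cyclic order i, j, k,
  l, the arcs ik and jl cross.\<close>

lemma triangle_unique: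
  assumes "{i, j, k} \<in> triangles T" "{i, j, l} \<in> triangles T" "cw i j k \<longleftrightarrow> cw i j l"
  shows "k = l"
proof (rule ccontr)
  assume "k \<noteq> l"
  have t: "{i, k} \<in> T" "{j, k} \<in> T" "{i, l} \<in> T" "{j, l} \<in> T" "i \<noteq> k" "j \<noteq> k" "i \<noteq> l" "j \<noteq> l" "i \<noteq> j"
    using assms(1,2) by (auto simp: triangles_iff)
  have "cw i j k \<and> cw i j l \<or> cw i k j \<and> cw i l j"
    using assms(3) t(5-) cw_total by metis
  moreover have "cw i k l \<or> cw i l k"
    using cw_total t \<open>k \<noteq> l\<close> by blast
  ultimately have "cw i j k \<and> cw k l i \<or> cw i j l \<and> cw l k i \<or> cw i k l \<and> cw l j i \<or> cw i l k \<and> cw k j i"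
    using cw_rotate by metis
  moreover have "cw i j k \<and> cw k l i \<Longrightarrow> False" "cw i k l \<and> cw l j i \<Longrightarrow> False"
    "cw i j l \<and> cw l k i \<Longrightarrow> False" "cw i l k \<and> cw k j i \<Longrightarrow> False"
    using noncrossing [of i k j l] noncrossing [of i l j k] noncrossing [of i l k j]
      noncrossing [of i k l j] t(1-4) by (auto simp: insert_commute)
  ultimately show False by blast
qed

text \<open>The number of clockwise steps from \<open>p\<close> to \<open>x\<close>. It turns the
  cyclic order seen from \<open>p\<close> into a linear one.\<close>

definition offset :: "nat \<Rightarrow> nat \<Rightarrow> nat" where
  "offset p x = (if p \<le> x then x - p else x + n - p)"

lemma cw_offset: "p < n \<Longrightarrow> x < n \<Longrightarrow> y < n \<Longrightarrow> cw p x y \<longleftrightarrow> 0 < offset p x \<and> offset p x < offset p y"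
  unfolding cw_def offset_def by auto

text \<open>The apex \<open>r\<close> is the last neighbour of \<open>p\<close> before
  \<open>q\<close>. An arc crossing \<open>rq\<close> from a vertex \<open>b\<close> between
  \<open>r\<close> and \<open>q\<close> would end at \<open>p\<close>, against the choice of
  \<open>r\<close>, or would cross \<open>pq\<close> or \<open>pr\<close>.\<close>

lemma triangle_on_side:
  assumes "{p, q} \<in> T" "j < n" "cw p j q"
  obtains r where "cw p r q" "{p, r} \<in> T" "{r, q} \<in> T"
proof -
  have pq: "p < n" "q < n" "p \<noteq> q" using arc_bounds assms(1) by auto
  define P where "P r \<longleftrightarrow> cw p r q \<and> {p, r} \<in> T" for r
  \<comment> \<open>Since \<open>j\<close> lies strictly between \<open>p\<close> and
    \<open>q\<close>, the successor of \<open>p\<close> is not \<open>q\<close> and is a first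
    candidate.\<close>
  have "P (Suc p mod n)"
    unfolding P_def using side_arc [OF pq(1)] assms pq
    by (cases "Suc p = n") (auto simp: cw_def)
  moreover have "\<forall>y. P y \<longrightarrow> offset p y < 2 * n"
    unfolding P_def offset_def using arc_bounds by fastforce
  ultimately obtain r where r: "P r" and max: "\<And>y. P y \<Longrightarrow> offset p y \<le> offset p r"
    using ex_has_greatest_nat [of P _ "offset p"] by blast
  have rn: "r < n" and r': "cw p r q" "{p, r} \<in> T" using r arc_bounds unfolding P_def by auto
  have "{r, q} \<in> T"
  proof (rule arcI)
    show "r \<noteq> q" using r' cw_distinct by blast
    fix b d assume bd: "{b, d} \<in> T" "cw r b q" "cw q d r"
    have bn: "b < n" using arc_bounds bd by blast
    have b: "cw p b q" "cw p r b" using cw_trans [OF r'(1) bd(2)] by auto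
    have "d = p \<or> cw q d p \<or> cw p d r"
      using r'(1) bd(3) unfolding cw_def by auto
    then show False
    proof (elim disjE)
      assume "d = p"
      then have "P b" unfolding P_def using b bd by (simp add: insert_commute)
      then show False using max [of b] b(2) cw_offset pq(1) rn bn by force
    next
      assume "cw q d p"
      then show False using noncrossing [OF assms(1) bd(1) b(1)] by blast
    next
      assume "cw p d r"
      then show False using noncrossing [OF r'(2), of d b] bd(1) b(2) cw_rotate
        by (metis insert_commute)
    qed
  qed (use rn pq in auto)
  then show thesis using that r' by blast
qed

end

section \<open>Exchanging the diagonal of a quadrilateral\<close>

locale quadrilateral = triangulated_polygon +
  fixes v0 v1 v2 v3 :: nat
  assumes cw012: "cw v0 v1 v2" and cw230: "cw v2 v3 v0"
    and t012: "{v0, v1, v2} \<in> triangles T" and t023: "{v0, v2, v3} \<in> triangles T"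
begin

abbreviation "T' \<equiv> insert {v1, v3} (T - {{v0, v2}})"

lemma sides: "{v0, v1} \<in> T" "{v1, v2} \<in> T" "{v2, v3} \<in> T" "{v3, v0} \<in> T" "{v0, v2} \<in> T"
  using t012 t023 by (auto simp: triangles_iff insert_commute)

lemma distinct: "v0 \<noteq> v1" "v0 \<noteq> v2" "v0 \<noteq> v3" "v1 \<noteq> v2" "v1 \<noteq> v3" "v2 \<noteq> v3"
  using cw012 cw230 unfolding cw_def by auto

lemma cw123: "cw v1 v2 v3" and cw301: "cw v3 v0 v1"
  using cw012 cw230 unfolding cw_def by auto

lemma diagonals_cross: "crossing {v0, v2} {v1, v3}"
  using cw012 cw230 crossing_iff by blast

lemma new_diagonal_notin: "{v1, v3} \<notin> T"
  using noncrossing [OF sides(5) _ cw012 cw230] by blast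

text \<open>Such an arc joins the side of \<open>v2\<close> to the side of \<open>v0\<close>. An
  endpoint other than \<open>v2\<close> or \<open>v0\<close> would make it cross one of the four
  sides of the quadrilateral.\<close>

lemma crossing_new_diagonal:
  assumes "f \<in> T" "crossing {v1, v3} f"
  shows "f = {v0, v2}"
proof -
  obtain a b where f: "f = {a, b}" "cw v1 a v3" "cw v3 b v1"
    using arc_cases [OF assms(1)] assms(2) by (metis crossing_iff insert_commute)
  have ab: "{a, b} \<in> T" "{b, a} \<in> T" using assms f by (auto simp: insert_commute)
  note nc = noncrossing [OF sides(1) ab(2)] noncrossing [OF sides(2) ab(1)]
    noncrossing [OF sides(3) ab(1)] noncrossing [OF sides(4) ab(2)]
  have a: "a = v2 \<or> cw v1 a v2 \<or> cw v2 a v3"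
    using cw_split [OF cw123 f(2)] .
  have b: "b = v0 \<or> cw v3 b v0 \<or> cw v0 b v1"
    using cw_split [OF cw301 f(3)] .
  have "a = v2" using a nc(2,3) cw_widen [OF cw123 f(3)] by blast
  moreover have "b = v0" using b nc(1,4) cw_widen [OF cw301 f(2)] by blast
  ultimately show ?thesis using f by (simp add: insert_commute)
qed

text \<open>The counterpart that gives maximality after the flip: an arc across the removed diagonal
  must leave through \<open>v1\<close> and \<open>v3\<close>, since otherwise it crosses one of the
  four sides.\<close>

lemma crossing_old_diagonal:
  assumes "{a, b} \<in> polygon_arcs n" "crossing {v0, v2} {a, b}"
    and "\<And>f. f \<in> T' \<Longrightarrow> \<not> crossing {a, b} f"
  shows "{a, b} = {v1, v3}"
proof -
  have "\<exists>x y. {a, b} = {x, y} \<and> cw v0 x v2 \<and> cw v2 y v0"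
    using assms(2) crossing_iff by (metis insert_commute)
  then obtain x y where f: "{a, b} = {x, y}" "cw v0 x v2" "cw v2 y v0" by blast
  have T': "{v0, v1} \<in> T'" "{v1, v2} \<in> T'" "{v2, v3} \<in> T'" "{v3, v0} \<in> T'"
    using sides distinct by (auto simp: doubleton_eq_iff)
  have "\<not> crossing g {x, y}" if "g \<in> T'" for g
    using assms(3) [OF that] crossing_sym f(1) by auto
  note nc = T' [THEN this, unfolded crossing_iff]
  have x: "x = v1 \<or> cw v0 x v1 \<or> cw v1 x v2"
    using f(2) cw012 cw_split by blast
  have y: "y = v3 \<or> cw v2 y v3 \<or> cw v3 y v0"
    using f(3) cw230 cw_split by blast
  have "x = v1" using x nc(1,2) cw_widen [OF cw012 f(3)] by blast
  moreover have "y = v3" using y nc(3,4) cw_widen [OF cw230 f(2)] by blast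
  ultimately show ?thesis using f by simp
qed

lemma triangulation_flip: "triangulation n T'"
  unfolding triangulation_def
proof (intro conjI ballI impI)
  show "T' \<subseteq> polygon_arcs n"
  proof -
    have "{v1, v3} \<in> polygon_arcs n"
      using arc_bounds [OF sides(1)] arc_bounds [OF sides(3)] distinct
      unfolding polygon_arcs_def by blast
    then show ?thesis using triangulation unfolding triangulation_def by auto
  qed
next
  fix e f assume ef: "e \<in> T'" "f \<in> T'"
  have "\<not> crossing e f" if "e \<in> T" "f \<in> T" for e f
    using that triangulation unfolding triangulation_def by blast
  moreover have "\<not> crossing {v1, v3} {v1, v3}"
    by (auto simp: crossing_iff cw_def)
  ultimately show "\<not> crossing e f"
    using ef crossing_new_diagonal crossing_sym by blast
next
  fix e assume e: "e \<in> polygon_arcs n" "\<forall>f\<in>T'. \<not> crossing e f"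
  show "e \<in> T'"
  proof (cases "crossing {v0, v2} e")
    case True
    obtain a b where "e = {a, b}" using e(1) unfolding polygon_arcs_def by blast
    then have "e = {v1, v3}" using crossing_old_diagonal e True by blast
    then show ?thesis by simp
  next
    case False
    then have "\<forall>f\<in>T. \<not> crossing e f" using e crossing_sym by blast
    then have "e \<in> T" using e triangulation unfolding triangulation_def by blast
    moreover have "e \<noteq> {v0, v2}" using e diagonals_cross by blast
    ultimately show ?thesis by blast
  qed
qed

lemma flip_polygon: "triangulated_polygon n T'"
  using n_ge triangulation_flip by unfold_locales

lemma flip_triangle_cases:
  assumes "t \<in> triangles T'"
  shows "t = {v0, v1, v3} \<or> t = {v1, v2, v3} \<or> t \<in> triangles T"
proof -
  interpret f: triangulated_polygon n T' by (rule flip_polygon)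
  obtain i j k where t: "t = {i, j, k}"
    using triangles_cases [OF assms] .
  then have t': "{i, j, k} \<in> triangles T'" using assms by simp
  \<comment> \<open>The new diagonal already carries a known triangle on each side, and there is no
    second one.\<close>
  have new: "x = v0 \<or> x = v2" if "{v1, v3, x} \<in> triangles T'" for x
  proof -
    have x: "{v1, x} \<in> T'" "{v3, x} \<in> T'" "x \<noteq> v1" "x \<noteq> v3" using that by (auto simp: triangles_iff)
    have 0: "{v1, v3, v0} \<in> triangles T'" "{v1, v3, v2} \<in> triangles T'"
      using sides distinct by (auto simp: triangles_iff insert_commute doubleton_eq_iff)
    have "cw v1 v3 v0" "\<not> cw v1 v3 v2"
      using cw_rotate [OF cw301] cw_rotate cw_asym [OF cw123] by blast+
    then show ?thesis
      using f.triangle_unique [OF that 0(1)] f.triangle_unique [OF that 0(2)] by blast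
  qed
  show ?thesis
  proof (cases "{v1, v3} \<subseteq> t")
    case True
    then have "t = {v1, v3, i} \<or> t = {v1, v3, j} \<or> t = {v1, v3, k}"
      unfolding t using distinct by auto
    then obtain x where "t = {v1, v3, x}" by blast
    then show ?thesis using new [of x] assms by (auto simp: insert_commute)
  next
    case False
    then have "{i, j} \<noteq> {v1, v3}" "{j, k} \<noteq> {v1, v3}" "{i, k} \<noteq> {v1, v3}" using t by auto
    then show ?thesis using t' unfolding t triangles_iff by simp
  qed
qed

end

context triangulated_polygon
begin

text \<open>The diagonal \<open>pr\<close> does not end at \<open>i\<close>. Flipping it keeps all
  arcs at \<open>i\<close> and adds the arc \<open>si\<close>, which is the move that leads to the
  fan.\<close>

lemma missing_arc_quadrilateral:
  assumes "i < n" "j < n" "i \<noteq> j" "{i, j} \<notin> T"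
  obtains p s r where "quadrilateral n T p s r i"
proof -
  define P where "P x \<longleftrightarrow> {i, x} \<in> T \<and> cw i x j" for x
  have "Suc i mod n \<noteq> j" using side_arc [OF assms(1)] assms(4) by auto
  then have "P (Suc i mod n)"
    unfolding P_def using side_arc [OF assms(1)] assms
    by (cases "Suc i = n") (auto simp: cw_def)
  \<comment> \<open>\<open>p\<close> is the last neighbour of \<open>i\<close> before \<open>j\<close>, so \<open>j\<close> is cut off by the third side of the
    triangle on the edge \<open>ip\<close>.\<close>
  moreover have "\<forall>y. P y \<longrightarrow> offset i y < 2 * n"
    unfolding P_def offset_def using arc_bounds by fastforce
  ultimately obtain p where p: "P p" and max: "\<And>y. P y \<Longrightarrow> offset i y \<le> offset i p"
    using ex_has_greatest_nat [of P _ "offset i"] by blast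
  have p': "{p, i} \<in> T" "cw i p j" "p < n"
    using p arc_bounds unfolding P_def by (auto simp: insert_commute)
  obtain r where r: "cw p r i" "{p, r} \<in> T" "{r, i} \<in> T"
    using triangle_on_side [OF p'(1) assms(2) cw_rotate [OF p'(2)]] .
  have rn: "r < n" using r arc_bounds by blast
  have "cw i p r" using r(1) cw_rotate by blast
  then have "\<not> P r" using max [of r] cw_offset assms(1) p'(3) rn by fastforce
  then have "\<not> cw i r j" using r(3) unfolding P_def by (simp add: insert_commute)
  moreover have "r \<noteq> j" using r(3) assms(4) by (auto simp: insert_commute)
  ultimately have "cw p j r" using p'(2) r(1) unfolding cw_def by auto
  then obtain s where s: "cw p s r" "{p, s} \<in> T" "{s, r} \<in> T"
    using triangle_on_side r(2) assms(2) by blast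
  have "quadrilateral n T p s r i"
  proof unfold_locales
    show "cw p s r" by (rule s)
    show "cw r i p" using r(1) cw_rotate by blast
    show "{p, s, r} \<in> triangles T" "{p, r, i} \<in> triangles T"
      using r s p' cw_distinct [OF s(1)] cw_distinct [OF r(1)] unfolding triangles_iff
      by (auto simp: insert_commute)
  qed
  then show thesis by (rule that)
qed

end

text \<open>Reading from the other end of the diagonal serves the case of the opposite
  orientation.\<close>

lemma (in quadrilateral) opposite: "quadrilateral n T v2 v3 v0 v1"
  using cw012 cw230 t012 t023 by unfold_locales (auto simp: insert_commute)

section \<open>Flips of decorations\<close>

locale decorated_triangulation = positive_superalgebra Ev Od Pos + triangulated_polygon n "arcs D"
  for Ev Od Pos :: "'a::real_algebra_1 set" and n and D :: "'a decoration" +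
  assumes decorated: "decorated_polygon Od Pos n D"
begin

lemma orientation: "edge_orientation (arcs D) (orient D)"
  using decorated unfolding decorated_polygon_def by blast

lemma orient_arc: "(x, y) \<in> orient D \<Longrightarrow> {x, y} \<in> arcs D"
  and orient_iff: "{x, y} \<in> arcs D \<Longrightarrow> (x, y) \<in> orient D \<longleftrightarrow> (y, x) \<notin> orient D"
  using orientation unfolding edge_orientation_def by auto

lemma lam_Pos: "{x, y} \<in> arcs D \<Longrightarrow> lam D {x, y} \<in> Pos"
  and mu_Od: "t \<in> triangles (arcs D) \<Longrightarrow> mu D t \<in> Od"
  using decorated unfolding decorated_polygon_def by blast+

end

lemma decorated_triangulationI:
  "positive_superalgebra Ev Od Pos \<Longrightarrow> 3 \<le> n \<Longrightarrow> decorated_polygon Od Pos n D \<Longrightarrow>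
    decorated_triangulation Ev Od Pos n D"
  by (simp add: decorated_triangulation_def decorated_triangulation_axioms_def
      triangulated_polygon_def decorated_polygon_def)

locale ptolemy_flip = decorated_triangulation Ev Od Pos n D + quadrilateral n "arcs D" v0 v1 v2 v3
  for Ev Od Pos :: "'a::real_algebra_1 set" and n and D :: "'a decoration" and v0 v1 v2 v3 +
  fixes D' :: "'a decoration"
  assumes oriented: "(v0, v2) \<in> orient D"
    and arcs': "arcs D' = insert {v1, v3} (arcs D - {{v0, v2}})"
    and orient': "orient D' = insert (v3, v1) (reverse_edge v1 v2 (orient D - {(v0, v2)}))"
    and lam': "lam D' = (lam D)({v1, v3} :=
      ptolemy_lam (lam D {v0, v1}) (lam D {v1, v2}) (lam D {v2, v3}) (lam D {v3, v0})
        (lam D {v0, v2}) (mu D {v0, v1, v2}) (mu D {v0, v2, v3}))"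
    and mu': "mu D' = (mu D)(
      {v0, v1, v3} := ptolemy_mu1 (lam D {v0, v1}) (lam D {v1, v2}) (lam D {v2, v3}) (lam D {v3, v0})
        (mu D {v0, v1, v2}) (mu D {v0, v2, v3}),
      {v1, v2, v3} := ptolemy_mu2 (lam D {v0, v1}) (lam D {v1, v2}) (lam D {v2, v3}) (lam D {v3, v0})
        (mu D {v0, v1, v2}) (mu D {v0, v2, v3}))"
begin

lemma orient'_iff:
  "(x, y) \<in> orient D' \<longleftrightarrow>
    (if {x, y} = {v1, v3} then (x, y) = (v3, v1)
     else if {x, y} = {v0, v2} then False
     else if {x, y} = {v1, v2} then (y, x) \<in> orient D
     else (x, y) \<in> orient D)"
proof -
  have "(v2, v0) \<notin> orient D" using orient_iff oriented orient_arc by blast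
  moreover have "(v1, v3) \<notin> orient D" "(v3, v1) \<notin> orient D"
    using orient_arc new_diagonal_notin by (metis insert_commute)+
  ultimately have *: "(x, y) \<in> orient D' \<longleftrightarrow> (x, y) = (v3, v1) \<or>
      (if {x, y} = {v1, v2} then (y, x) \<in> orient D \<and> (y, x) \<noteq> (v0, v2)
       else (x, y) \<in> orient D \<and> (x, y) \<noteq> (v0, v2))"
    and n: "(v2, v0) \<notin> orient D" "(v1, v3) \<notin> orient D" "(v3, v1) \<notin> orient D"
    unfolding orient' reverse_edge_def by auto
  consider "x = v1" "y = v3" | "x = v3" "y = v1" | "x = v0" "y = v2" | "x = v2" "y = v0"
    | "{x, y} \<noteq> {v1, v3}" "{x, y} \<noteq> {v0, v2}"
    by (metis doubleton_eq_iff)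
  then show ?thesis
  proof cases
    case 5
    then have "(x, y) \<noteq> (v3, v1)" "(x, y) \<noteq> (v0, v2)" "(y, x) \<noteq> (v0, v2)" by auto
    then show ?thesis unfolding * using 5 by auto
  qed (unfold *, use distinct n in \<open>simp_all add: doubleton_eq_iff\<close>)
qed

lemma orientation': "edge_orientation (arcs D') (orient D')"
proof -
  have "{x, y} \<in> arcs D'" if "(x, y) \<in> orient D'" for x y
  proof -
    have "{x, y} = {v1, v3} \<or> {x, y} \<noteq> {v0, v2} \<and> ((x, y) \<in> orient D \<or> (y, x) \<in> orient D)"
      using that unfolding orient'_iff by (simp split: if_splits)
    moreover have "{y, x} = {x, y}" by blast
    ultimately show ?thesis
      using orient_arc [of x y] orient_arc [of y x] unfolding arcs' by auto
  qed
  moreover have "(x, y) \<in> orient D' \<longleftrightarrow> (y, x) \<notin> orient D'" if "{x, y} \<in> arcs D'" for x y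
  proof -
    have c: "{x, y} = {y, x}" by blast
    have "{x, y} = {v1, v3} \<or> {x, y} \<noteq> {v1, v3} \<and> {x, y} \<noteq> {v0, v2} \<and> {x, y} \<in> arcs D"
      using that unfolding arcs' by (cases "{x, y} = {v1, v3}") simp_all
    then show ?thesis
    proof (elim disjE conjE)
      assume "{x, y} = {v1, v3}"
      then show ?thesis using distinct unfolding orient'_iff c [symmetric]
        by (auto simp: doubleton_eq_iff)
    next
      assume "{x, y} \<noteq> {v1, v3}" "{x, y} \<noteq> {v0, v2}" "{x, y} \<in> arcs D"
      then show ?thesis using orient_iff [of x y] unfolding orient'_iff c [symmetric] by auto
    qed
  qed
  ultimately show ?thesis unfolding edge_orientation_def by auto
qed

lemma quad_Pos: "lam D {v0, v1} \<in> Pos" "lam D {v1, v2} \<in> Pos" "lam D {v2, v3} \<in> Pos"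
    "lam D {v3, v0} \<in> Pos" "lam D {v0, v2} \<in> Pos"
  and quad_Od: "mu D {v0, v1, v2} \<in> Od" "mu D {v0, v2, v3} \<in> Od"
  using lam_Pos sides mu_Od t012 t023 by auto

lemma decorated': "decorated_polygon Od Pos n D'"
  unfolding decorated_polygon_def
proof (intro conjI ballI)
  show "triangulation n (arcs D')" unfolding arcs' by (rule triangulation_flip)
  show "edge_orientation (arcs D') (orient D')" by (rule orientation')
  fix e assume "e \<in> arcs D'"
  then show "lam D' e \<in> Pos"
    using decorated ptolemy_lam_Pos [OF quad_Pos quad_Od]
    unfolding arcs' lam' decorated_polygon_def by auto
next
  fix t assume "t \<in> triangles (arcs D')"
  then have "t = {v0, v1, v3} \<or> t = {v1, v2, v3} \<or> t \<in> triangles (arcs D)"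
    unfolding arcs' by (rule flip_triangle_cases)
  then show "mu D' t \<in> Od"
    using mu_Od ptolemy_mu_Od [OF quad_Pos quad_Od] unfolding mu' by auto
qed

lemma lam_old: "{x, y} \<in> arcs D \<Longrightarrow> lam D' {x, y} = lam D {x, y}"
  using new_diagonal_notin unfolding lam' by auto

lemma mu_old: "t \<in> triangles (arcs D) \<Longrightarrow> mu D' t = mu D t"
  using new_diagonal_notin triangles_iff [of v0 v1 v3 "arcs D"] triangles_iff [of v1 v2 v3 "arcs D"]
  unfolding mu' by auto

lemma super_flip: "super_flip Pos D D'"
proof -
  have "D' = \<lparr>arcs = arcs D', orient = orient D', lam = lam D', mu = mu D'\<rparr>" by simp
  then show ?thesis
    unfolding arcs' orient' lam' mu' ptolemy_lam_def ptolemy_mu1_def ptolemy_mu2_def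
      ptolemy_ratio_def
    using super_flip.intros [OF cw012 cw230 oriented t012 t023 HOL.refl HOL.refl HOL.refl HOL.refl HOL.refl HOL.refl HOL.refl HOL.refl]
    by simp
qed

end

context positive_superalgebra
begin

lemma super_flip_cases:
  assumes "super_flip Pos D D'" "decorated_polygon Od Pos n D" "3 \<le> n"
  obtains v0 v1 v2 v3 where "ptolemy_flip Ev Od Pos n D v0 v1 v2 v3 D'"
  using assms(1)
proof cases
  case (1 v0 v1 v2 v3 a b c d e \<theta> \<sigma> chi)
  have "ptolemy_flip Ev Od Pos n D v0 v1 v2 v3 D'"
    using 1(2-6) assms(2,3) unfolding 1(1)
    by unfold_locales
      (simp_all add: 1(7-) decorated_polygon_def ptolemy_lam_def ptolemy_mu1_def ptolemy_mu2_def
        ptolemy_ratio_def)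
  then show thesis by (rule that)
qed

text \<open>\<open>super_flip\<close> names the vertices according to the orientation of the
  diagonal. If it points from \<open>v2\<close> to \<open>v0\<close>, the quadrilateral is read from
  \<open>v2\<close>; the sets of arcs stay the same.\<close>

lemma flip_exists:
  assumes "quadrilateral n (arcs D) v0 v1 v2 v3" "decorated_polygon Od Pos n D"
  obtains D' where "super_flip Pos D D'" "decorated_polygon Od Pos n D'"
    "arcs D' = insert {v1, v3} (arcs D - {{v0, v2}})"
    "\<And>x y. {x, y} \<in> arcs D \<Longrightarrow> lam D' {x, y} = lam D {x, y}"
proof -
  note result = that
  have *: thesis if q: "quadrilateral n (arcs D) u0 u1 u2 u3" and o: "(u0, u2) \<in> orient D"
    and u: "{u1, u3} = {v1, v3}" "{u0, u2} = {v0, v2}" for u0 u1 u2 u3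
  proof -
    interpret quadrilateral n "arcs D" u0 u1 u2 u3 by (rule q)
    define D' where "D' = \<lparr> arcs = insert {u1, u3} (arcs D - {{u0, u2}}),
      orient = insert (u3, u1) (reverse_edge u1 u2 (orient D - {(u0, u2)})),
      lam = (lam D)({u1, u3} :=
        ptolemy_lam (lam D {u0, u1}) (lam D {u1, u2}) (lam D {u2, u3}) (lam D {u3, u0})
          (lam D {u0, u2}) (mu D {u0, u1, u2}) (mu D {u0, u2, u3})),
      mu = (mu D)(
        {u0, u1, u3} := ptolemy_mu1 (lam D {u0, u1}) (lam D {u1, u2}) (lam D {u2, u3}) (lam D {u3, u0})
          (mu D {u0, u1, u2}) (mu D {u0, u2, u3}),
        {u1, u2, u3} := ptolemy_mu2 (lam D {u0, u1}) (lam D {u1, u2}) (lam D {u2, u3}) (lam D {u3, u0})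
          (mu D {u0, u1, u2}) (mu D {u0, u2, u3})) \<rparr>"
    interpret f: ptolemy_flip Ev Od Pos n D u0 u1 u2 u3 D'
      by unfold_locales (simp_all add: D'_def o assms(2))
    show thesis
      using result [OF f.super_flip f.decorated' _ f.lam_old] f.arcs' u by simp
  qed
  interpret quadrilateral n "arcs D" v0 v1 v2 v3 by (rule assms)
  have "(v0, v2) \<in> orient D \<or> (v2, v0) \<in> orient D"
    using assms(2) sides(5) unfolding decorated_polygon_def edge_orientation_def by blast
  then show thesis
    using * [OF assms(1)] * [OF opposite] by (auto simp: insert_commute)
qed

section \<open>Flipping to a fan\<close>

definition is_fan :: "nat \<Rightarrow> nat \<Rightarrow> nat set set \<Rightarrow> bool" where
  "is_fan n i T \<longleftrightarrow> (\<forall>j<n. j \<noteq> i \<longrightarrow> {i, j} \<in> T)"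

text \<open>Induction on the number of vertices not joined to \<open>i\<close>. Every diagonal that
  is flipped lies opposite to \<open>i\<close>, so no arc at \<open>i\<close> is lost and the length
  of each is preserved.\<close>

lemma fan_reachable:
  assumes "3 \<le> n" "i < n" "decorated_polygon Od Pos n D"
  shows "\<exists>F. (super_flip Pos)\<^sup>*\<^sup>* D F \<and> decorated_polygon Od Pos n F \<and> is_fan n i (arcs F) \<and>
    (\<forall>j. {i, j} \<in> arcs D \<longrightarrow> lam F {i, j} = lam D {i, j})"
  using assms(3)
proof (induction "card {j. j < n \<and> j \<noteq> i \<and> {i, j} \<notin> arcs D}" arbitrary: D rule: less_induct)
  case less
  interpret triangulated_polygon n "arcs D"
    using assms(1) less.prems unfolding decorated_polygon_def by unfold_locales auto
  show ?case
  proof (cases "is_fan n i (arcs D)")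
    case True
    then show ?thesis using less.prems by blast
  next
    case False
    then obtain j where "j < n" "j \<noteq> i" "{i, j} \<notin> arcs D" unfolding is_fan_def by blast
    then obtain p s r where q: "quadrilateral n (arcs D) p s r i"
      using missing_arc_quadrilateral assms(2) by metis
    then interpret quadrilateral n "arcs D" p s r i .
    obtain D' where D': "super_flip Pos D D'" "decorated_polygon Od Pos n D'"
      "arcs D' = insert {s, i} (arcs D - {{p, r}})"
      "\<And>x y. {x, y} \<in> arcs D \<Longrightarrow> lam D' {x, y} = lam D {x, y}"
      using flip_exists [OF q less.prems] by blast
    have keep: "{i, j} \<in> arcs D'" if "{i, j} \<in> arcs D" for j
      using that distinct unfolding D'(3) by (auto simp: doubleton_eq_iff)
    have "{j. j < n \<and> j \<noteq> i \<and> {i, j} \<notin> arcs D'} \<subset> {j. j < n \<and> j \<noteq> i \<and> {i, j} \<notin> arcs D}"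
    proof
      show "{j. j < n \<and> j \<noteq> i \<and> {i, j} \<notin> arcs D'} \<subseteq> {j. j < n \<and> j \<noteq> i \<and> {i, j} \<notin> arcs D}"
        using keep by blast
      have "s < n" "s \<noteq> i" "{i, s} \<notin> arcs D" "{i, s} \<in> arcs D'"
        using arc_bounds [OF sides(1)] distinct new_diagonal_notin D'(3)
        by (auto simp: insert_commute)
      then show "{j. j < n \<and> j \<noteq> i \<and> {i, j} \<notin> arcs D'} \<noteq> {j. j < n \<and> j \<noteq> i \<and> {i, j} \<notin> arcs D}"
        by blast
    qed
    then have "card {j. j < n \<and> j \<noteq> i \<and> {i, j} \<notin> arcs D'} < card {j. j < n \<and> j \<noteq> i \<and> {i, j} \<notin> arcs D}"
      by (intro psubset_card_mono) auto
    from less.hyps [OF this D'(2)] obtain F where F: "(super_flip Pos)\<^sup>*\<^sup>* D' F"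
      "decorated_polygon Od Pos n F" "is_fan n i (arcs F)"
      "\<forall>j. {i, j} \<in> arcs D' \<longrightarrow> lam F {i, j} = lam D' {i, j}"
      by blast
    have "(super_flip Pos)\<^sup>*\<^sup>* D F" using D'(1) F(1) by (rule converse_rtranclp_into_rtranclp)
    moreover have "lam F {i, j} = lam D {i, j}" if "{i, j} \<in> arcs D" for j
      using F(4) keep D'(4) that by metis
    ultimately show ?thesis using F by blast
  qed
qed

end

section \<open>Potentials of the connection\<close>

lemma matrix_inv_mult:
  fixes M :: "'a::semiring_1^'n^'n"
  assumes "invertible M"
  shows "M ** matrix_inv M = mat 1" "matrix_inv M ** M = mat 1"
  using someI_ex [OF assms [unfolded invertible_def]] unfolding matrix_inv_def by auto

lemma matrix_inv_cancel:
  fixes M :: "'a::semiring_1^'n^'n"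
  assumes "invertible M"
  shows "M ** (matrix_inv M ** X) = X" "matrix_inv M ** (M ** X) = X"
  using matrix_inv_mult [OF assms] by (simp_all add: matrix_mul_assoc)

lemma invertible_cancel:
  fixes M :: "'a::semiring_1^'n^'n"
  assumes "invertible M" "M ** X = M ** Y"
  shows "X = Y"
  using assms matrix_inv_cancel(2) by metis

lemma invertible_cancel_right:
  fixes M :: "'a::semiring_1^'n^'n"
  assumes "invertible M" "X ** M = Y ** M"
  shows "X = Y"
proof -
  have "X ** M ** matrix_inv M = Y ** M ** matrix_inv M" by (simp add: assms(2))
  then show ?thesis using matrix_inv_mult [OF assms(1)] by (simp flip: matrix_mul_assoc)
qed

lemma invertible_B_mat: "invertible (B_mat x p)"
  unfolding invertible_def
  \<comment> \<open>The witness solves the addition law \<open>B_mat_mult\<close>; the term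
    \<open>p * p\<close> remains because \<open>p\<close> is an arbitrary ring element here.\<close>
  by (rule exI [of _ "B_mat (- x - p * p) (- p)"]) (simp add: B_mat_mult flip: B_mat_zero)

lemma invertible_rho: "invertible (rho_mat :: 'a::real_algebra_1^3^3)"
  unfolding invertible_def using rho_mult_rho by blast

lemma rho_cancel: "rho_mat ** (rho_mat ** X) = (X :: 'a::real_algebra_1^'n^3)"
  by (simp add: matrix_mul_assoc rho_mult_rho)

text \<open>The shape contains the angle matrices and both crossing matrices, that is, all edges
  staying near one polygon vertex. It is closed under products and inverses and multiplies a
  (1,2)-entry only by a sign.\<close>

definition horocyclic :: "'a::real_algebra_1^3^3 \<Rightarrow> bool" where
  "horocyclic N \<longleftrightarrow> invertible N \<and> N $ 1 $ 1 \<in> {1, - 1} \<and> N $ 2 $ 2 \<in> {1, - 1} \<and>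
     N $ 1 $ 2 = 0 \<and> N $ 1 $ 3 = 0 \<and> N $ 3 $ 2 = 0"

lemma horocyclic_invertible: "horocyclic N \<Longrightarrow> invertible N"
  unfolding horocyclic_def by blast

lemma horocyclic_one: "horocyclic (mat 1)"
  unfolding horocyclic_def using invertible_mult [OF invertible_rho invertible_rho]
  by (simp add: rho_mult_rho) (simp add: mat_def)

lemma horocyclic_rho: "horocyclic rho_mat"
  unfolding horocyclic_def using invertible_rho by (auto simp: rho_mat_def)

lemma horocyclic_B_mat: "horocyclic (B_mat x p)"
  unfolding horocyclic_def using invertible_B_mat by (auto simp: B_mat_def)

lemma horocyclic_A_mat: "horocyclic (A_mat Pos h t)"
  unfolding A_mat_eq by (rule horocyclic_B_mat)

lemma horocyclic_mult: "horocyclic M \<Longrightarrow> horocyclic N \<Longrightarrow> horocyclic (M ** N)"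
  using invertible_mult [of M N] unfolding horocyclic_def
  by (simp add: matrix_matrix_mult_def sum_3) auto

text \<open>The first row of \<open>N ** M\<close> is a sign times the first row of
  \<open>M\<close>, and the second column of \<open>M ** N\<close> is a sign times the second column
  of \<open>M\<close>; both products are the identity.\<close>

lemma horocyclic_inverse:
  fixes N :: "'a::real_algebra_1^3^3"
  assumes "horocyclic N"
  shows "horocyclic (matrix_inv N)"
proof -
  define M where "M = matrix_inv N"
  have 1: "N ** M = mat 1" "M ** N = mat 1"
    unfolding M_def using matrix_inv_mult assms horocyclic_invertible by blast+
  have r: "(N ** M) $ 1 $ k = N $ 1 $ 1 * M $ 1 $ k" for k
    using assms unfolding horocyclic_def by (auto simp: matrix_matrix_mult_def sum_3)
  have c: "(M ** N) $ k $ 2 = M $ k $ 2 * N $ 2 $ 2" for k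
    using assms unfolding horocyclic_def by (auto simp: matrix_matrix_mult_def sum_3)
  have s: "N $ 1 $ 1 * (N $ 1 $ 1 * m) = m" "m * N $ 2 $ 2 * N $ 2 $ 2 = m" for m
    using assms unfolding horocyclic_def by auto
  have "M $ 1 $ k = N $ 1 $ 1 * (mat 1 :: 'a^3^3) $ 1 $ k" for k
    using r [of k] s(1) [of "M $ 1 $ k"] unfolding 1 by simp
  moreover have "M $ k $ 2 = (mat 1 :: 'a^3^3) $ k $ 2 * N $ 2 $ 2" for k
    using c [of k] s(2) [of "M $ k $ 2"] unfolding 1 by simp
  ultimately have "M $ 1 $ 1 = N $ 1 $ 1" "M $ 1 $ 2 = 0" "M $ 1 $ 3 = 0"
    "M $ 2 $ 2 = N $ 2 $ 2" "M $ 3 $ 2 = 0"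
    by (simp_all add: mat_def)
  moreover have "invertible M" unfolding invertible_def using 1 by blast
  ultimately show ?thesis using assms unfolding horocyclic_def M_def by simp
qed

lemma horocyclic_entry:
  fixes M N X :: "'a::real_algebra_1^3^3"
  assumes "horocyclic M" "horocyclic N"
  shows "(M ** (X ** N)) $ 1 $ 2 \<in> {X $ 1 $ 2, - (X $ 1 $ 2)}"
proof -
  have "(M ** Y) $ 1 $ 2 = M $ 1 $ 1 * Y $ 1 $ 2" for Y :: "'a^3^3"
    using assms(1) unfolding horocyclic_def by (auto simp: matrix_matrix_mult_def sum_3)
  moreover have "(X ** N) $ 1 $ 2 = X $ 1 $ 2 * N $ 2 $ 2"
    using assms(2) unfolding horocyclic_def by (auto simp: matrix_matrix_mult_def sum_3)
  ultimately show ?thesis using assms unfolding horocyclic_def by auto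
qed

text \<open>
  \<open>edge_sign D x y\<close> is the matrix of the edge of the graph that crosses \<open>xy\<close> near \<open>x\<close>.
\<close>

definition edge_sign :: "'a::real_algebra_1 decoration \<Rightarrow> nat \<Rightarrow> nat \<Rightarrow> 'a^3^3" where
  "edge_sign D x y = (if (x, y) \<in> orient D then mat 1 else rho_mat)"

lemma edge_sign_cancel: "edge_sign D x y ** (edge_sign D x y ** X) = X"
  by (simp add: edge_sign_def rho_cancel)

lemma horocyclic_edge_sign: "horocyclic (edge_sign D x y)"
  by (simp add: edge_sign_def horocyclic_one horocyclic_rho)

definition angle_mat where
  "angle_mat Pos D i j k = A_mat Pos (h_length D i j k) (mu D {i, j, k})"

lemma horocyclic_angle_mat: "horocyclic (angle_mat Pos D i j k)"
  unfolding angle_mat_def by (rule horocyclic_A_mat)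

text \<open>
  \<open>L x y\<close> is the value of the potential at \<open>(x, y, z)\<close> for \<open>cw x y z\<close>; its value on the other side of
  \<open>xy\<close> is \<open>edge_sign D x y ** L x y\<close>.  Imposing this on the sides of the polygon as well is harmless
  and avoids all case distinctions.
\<close>

definition realizes ::
    "'a::real_algebra_1 set \<Rightarrow> 'a decoration \<Rightarrow> (nat \<Rightarrow> nat \<Rightarrow> 'a^3^3) \<Rightarrow> (nat \<Rightarrow> 'a^3^3) \<Rightarrow> bool" where
  "realizes Pos D L P \<longleftrightarrow>
     (\<forall>x y. {x, y} \<in> arcs D \<longrightarrow> invertible (P x) \<and> (\<exists>N. horocyclic N \<and> L x y = N ** P x)) \<and>
     (\<forall>x y. {x, y} \<in> arcs D \<longrightarrow> edge_sign D x y ** L x y = E_mat (lam D {x, y}) ** L y x) \<and>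
     (\<forall>i j k. {i, j, k} \<in> triangles (arcs D) \<longrightarrow> cw i j k \<longrightarrow>
        L i j = angle_mat Pos D i j k ** (edge_sign D i k ** L i k))"

definition vertex_mat :: "'a::real_algebra_1 decoration \<Rightarrow> (nat \<Rightarrow> nat \<Rightarrow> 'a^3^3) \<Rightarrow> gvertex \<Rightarrow> 'a^3^3" where
  "vertex_mat D L = (\<lambda>(x, y, z). if cw x y z then L x y else edge_sign D x y ** L x y)"

context positive_superalgebra
begin

lemma E_mat_square: "x \<in> Pos \<Longrightarrow> E_mat x ** E_mat x = rho_mat"
  by (simp add: E_mat_def rho_mat_def mat3 ring_inv_left ring_inv_right)

lemma invertible_E_mat:
  assumes "x \<in> Pos" shows "invertible (E_mat x)"
proof -
  have "E_mat x ** (E_mat x ** rho_mat) = mat 1" "(E_mat x ** rho_mat) ** E_mat x = mat 1"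
    by (simp add: matrix_mul_assoc E_mat_square [OF assms] rho_mult_rho)
      (simp add: E_mat_square [OF assms] rho_mult_rho flip: rho_E matrix_mul_assoc)
  then show ?thesis unfolding invertible_def by blast
qed

text \<open>The crossing matrices at the two ends of an arc differ by \<open>rho_mat\<close>, which
  is the square of \<open>E_mat x\<close>. The edge relation therefore only needs to be checked in
  one direction.\<close>

lemma E_mat_sym:
  assumes "x \<in> Pos" "(u, v) \<in> orient D \<longleftrightarrow> (v, u) \<notin> orient D"
    and "edge_sign D u v ** M = E_mat x ** N"
  shows "edge_sign D v u ** N = E_mat x ** M"
proof (cases "(u, v) \<in> orient D")
  case True
  then show ?thesis using assms E_mat_square [OF assms(1)]
    by (simp add: edge_sign_def matrix_mul_assoc)
next
  case False
  then have "rho_mat ** (E_mat x ** M) = rho_mat ** N"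
    using assms(3) E_mat_square [OF assms(1)] unfolding edge_sign_def
    by (simp add: matrix_mul_assoc rho_E) (metis matrix_mul_assoc)
  then show ?thesis using False assms(2) invertible_cancel [OF invertible_rho] unfolding edge_sign_def by auto
qed

end

context decorated_triangulation
begin

lemma edge_relation_sym:
  assumes "{x, y} \<in> arcs D" "edge_sign D x y ** L x y = E_mat (lam D {x, y}) ** L y x"
  shows "edge_sign D y x ** L y x = E_mat (lam D {y, x}) ** L x y"
  using E_mat_sym [OF lam_Pos [OF assms(1)] orient_iff [OF assms(1)] assms(2)]
  by (simp add: insert_commute)

lemma triangle_hexagon:
  assumes "{i, j, k} \<in> triangles (arcs D)"
  shows "E_mat (lam D {k, i}) ** (angle_mat Pos D k i j ** (E_mat (lam D {j, k}) **
    (angle_mat Pos D j k i ** (E_mat (lam D {i, j}) ** angle_mat Pos D i j k)))) = mat 1"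
proof -
  have t: "{i, j} \<in> arcs D" "{j, k} \<in> arcs D" "{k, i} \<in> arcs D"
    using assms by (auto simp: triangles_iff insert_commute)
  have c: "{j, i} = {i, j}" "{k, j} = {j, k}" "{i, k} = {k, i}" "{j, k, i} = {i, j, k}"
    "{k, i, j} = {i, j, k}" by auto
  show ?thesis
    using hexagon [OF t [THEN lam_Pos] mu_Od [OF assms]]
    unfolding angle_mat_def h_length_def c .
qed

text \<open>\<open>M1\<close> to \<open>M6\<close> are the values of a potential in clockwise order
  around a hexagon. As the holonomy around the face is trivial, five edge relations imply the
  sixth.\<close>

lemma hexagon_side:
  assumes "{i, j, k} \<in> triangles (arcs D)"
    and "M2 = E_mat (lam D {i, j}) ** M1" "M3 = angle_mat Pos D j k i ** M2"
    "M4 = E_mat (lam D {j, k}) ** M3" "M5 = angle_mat Pos D k i j ** M4"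
    "M1 = angle_mat Pos D i j k ** M6"
  shows "M6 = E_mat (lam D {k, i}) ** M5"
  using arg_cong [OF triangle_hexagon [OF assms(1)], of "\<lambda>M. M ** M6"] assms(2-)
  by (simp flip: matrix_mul_assoc)

lemma hexagon_angle:
  assumes "{i, j, k} \<in> triangles (arcs D)"
    and "M2 = E_mat (lam D {i, j}) ** M1" "M3 = angle_mat Pos D j k i ** M2"
    "M4 = E_mat (lam D {j, k}) ** M3" "M6 = E_mat (lam D {k, i}) ** M5"
    "M1 = angle_mat Pos D i j k ** M6"
  shows "M5 = angle_mat Pos D k i j ** M4"
proof (rule invertible_cancel)
  have "{k, i} \<in> arcs D" using assms(1) by (simp add: triangles_iff insert_commute)
  then show "invertible (E_mat (lam D {k, i}))" using lam_Pos invertible_E_mat by blast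
  show "E_mat (lam D {k, i}) ** M5 = E_mat (lam D {k, i}) ** (angle_mat Pos D k i j ** M4)"
    using hexagon_side [OF assms(1-4) HOL.refl assms(6)] assms(5) by simp
qed

lemma connection_vertex_mat:
  assumes r: "realizes Pos D L P" and "connection Pos D u v M"
  shows "vertex_mat D L v = M ** vertex_mat D L u \<and> invertible M"
  using assms(2)
proof cases
  case (angle i j k)
  have "\<not> cw i k j" using angle cw_asym by blast
  then have "vertex_mat D L v = M ** vertex_mat D L u"
    using r angle unfolding vertex_mat_def realizes_def angle_mat_def by simp
  then show ?thesis using angle horocyclic_A_mat horocyclic_invertible by blast
next
  case (side i j k)
  have ij: "{i, j} \<in> arcs D" using side by (simp add: triangles_iff)
  have "\<not> cw j i k" using side cw_asym cw_rotate by blast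
  then have "vertex_mat D L v = M ** vertex_mat D L u"
    using r side ij unfolding vertex_mat_def realizes_def by (simp add: insert_commute)
  then show ?thesis using side lam_Pos [OF ij] invertible_E_mat by blast
next
  case (cross_tail i j k l)
  then show ?thesis
    using horocyclic_invertible [OF horocyclic_one] unfolding vertex_mat_def edge_sign_def by auto
next
  case (cross_head i j k l)
  have ij: "{i, j} \<in> arcs D" using cross_head by (simp add: triangles_iff)
  have "(j, i) \<notin> orient D" using orient_iff [OF ij] cross_head by blast
  \<comment> \<open>The two triangles lie on different sides of the diagonal, so exactly one of the
    two values carries the factor \<open>edge_sign\<close>.\<close>
  moreover have "cw j i k \<longleftrightarrow> \<not> cw j i l"
    using triangle_unique [of j i k l] cross_head by (auto simp: insert_commute)
  ultimately show ?thesis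
    using cross_head invertible_rho unfolding vertex_mat_def edge_sign_def
    by (auto simp: rho_cancel)
qed

lemma holonomy_vertex_mat:
  assumes r: "realizes Pos D L P" and "holonomy Pos D u v H"
  shows "vertex_mat D L v = H ** vertex_mat D L u"
  using assms(2)
proof induction
  case (forward v H w M)
  then show ?case using connection_vertex_mat [OF r forward(2)] by (simp add: matrix_mul_assoc)
next
  case (backward v H w M)
  then show ?case
    using connection_vertex_mat [OF r backward(2)] matrix_inv_cancel(2)
    by (metis matrix_mul_assoc)
qed simp

lemma near_vertex_mat:
  assumes "realizes Pos D L P" "near (arcs D) i u"
  obtains N where "horocyclic N" "vertex_mat D L u = N ** P i" "invertible (P i)"
proof -
  obtain j k where jk: "{i, j, k} \<in> triangles (arcs D)" "u = (i, j, k)"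
    using assms(2) unfolding near_def by blast
  then have "{i, j} \<in> arcs D" by (simp add: triangles_iff)
  then obtain N where N: "horocyclic N" "L i j = N ** P i" "invertible (P i)"
    using assms(1) unfolding realizes_def by blast
  show thesis
  proof (cases "cw i j k")
    case True
    then show thesis using that N jk unfolding vertex_mat_def by simp
  next
    case False
    then show thesis using that [OF horocyclic_mult [OF horocyclic_edge_sign [of D i j] N(1)]] N jk
      unfolding vertex_mat_def by (simp add: matrix_mul_assoc)
  qed
qed

text \<open>Both \<open>vertex_mat\<close> values are horocyclic multiples of \<open>P i\<close> and
  \<open>P j\<close>. Cancelling \<open>P i\<close> leaves \<open>H\<close> as \<open>X\<close>
  between two horocyclic matrices.\<close>

lemma holonomy_entry:
  assumes "realizes Pos D L P" "near (arcs D) i u" "near (arcs D) j v" "holonomy Pos D u v H"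
    and "P j = X ** P i"
  shows "H $ 1 $ 2 \<in> {X $ 1 $ 2, - (X $ 1 $ 2)}"
proof -
  obtain N1 where 1: "horocyclic N1" "vertex_mat D L u = N1 ** P i" "invertible (P i)"
    using near_vertex_mat [OF assms(1,2)] .
  obtain N2 where 2: "horocyclic N2" "vertex_mat D L v = N2 ** P j"
    using near_vertex_mat [OF assms(1,3)] .
  have "H ** N1 ** P i = N2 ** X ** P i"
    using holonomy_vertex_mat [OF assms(1,4)] 1 2 assms(5) by (simp add: matrix_mul_assoc)
  then have "H ** N1 = N2 ** X" using invertible_cancel_right 1(3) by blast
  then have "H ** N1 ** matrix_inv N1 = N2 ** X ** matrix_inv N1" by simp
  then have "H = N2 ** (X ** matrix_inv N1)"
    using matrix_inv_mult [OF horocyclic_invertible [OF 1(1)]] by (simp flip: matrix_mul_assoc)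
  then show ?thesis using horocyclic_entry [OF 2(1) horocyclic_inverse [OF 1(1)]] by simp
qed

end

section \<open>Pulling back a potential along a flip\<close>

lemma cw_same_triangle:
  assumes "{i, j, k} = {a, b, c}" "cw i j k" "cw a b c"
  shows "i = a \<and> j = b \<and> k = c \<or> i = b \<and> j = c \<and> k = a \<or> i = c \<and> j = a \<and> k = b"
proof -
  have "i \<in> {a, b, c}" "j \<in> {a, b, c}" "k \<in> {a, b, c}" using assms(1) by auto
  moreover have "\<not> cw a c b" "\<not> cw c b a" "\<not> cw b a c" "\<not> cw x x y" "\<not> cw x y y" "\<not> cw x y x" for x y
    using assms(3) unfolding cw_def by auto
  ultimately show ?thesis using assms(2) by (elim insertE emptyE) simp_all
qed

context ptolemy_flip
begin

lemma oriented': "(v2, v0) \<notin> orient D"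
  using orient_iff oriented orient_arc by blast

text \<open>The negated odd parameters at \<open>v1\<close> and \<open>v2\<close> appear as
  conjugations by \<open>rho_mat\<close>. In this form the factors match the crossing matrices of
  the two orientations.\<close>

lemma flip_angles:
  "angle_mat Pos D' v0 v1 v3 = angle_mat Pos D v0 v1 v2 ** angle_mat Pos D v0 v2 v3"
  "angle_mat Pos D v1 v2 v0 = rho_mat ** (angle_mat Pos D' v1 v2 v3 ** (rho_mat ** angle_mat Pos D' v1 v3 v0))"
  "angle_mat Pos D' v2 v3 v1 = angle_mat Pos D v2 v3 v0 ** (rho_mat ** (angle_mat Pos D v2 v0 v1 ** rho_mat))"
  "angle_mat Pos D v3 v0 v2 = angle_mat Pos D' v3 v0 v1 ** angle_mat Pos D' v3 v1 v2"
proof -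
  have t: "{v0, v1, v3} \<noteq> {v1, v2, v3}" using distinct by auto
  have c: "{v1, v0} = {v0, v1}" "{v2, v1} = {v1, v2}" "{v3, v2} = {v2, v3}" "{v0, v3} = {v3, v0}"
    "{v2, v0} = {v0, v2}" "{v3, v1} = {v1, v3}" by auto
  have ct: "{v1, v2, v0} = {v0, v1, v2}"
    "{v2, v0, v1} = {v0, v1, v2}" "{v2, v3, v0} = {v0, v2, v3}" "{v3, v0, v2} = {v0, v2, v3}"
    "{v1, v3, v0} = {v0, v1, v3}" "{v3, v0, v1} = {v0, v1, v3}" "{v2, v3, v1} = {v1, v2, v3}"
    "{v3, v1, v2} = {v1, v2, v3}" by auto
  have l: "lam D' {v1, v3} = ptolemy_lam (lam D {v0, v1}) (lam D {v1, v2}) (lam D {v2, v3})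
      (lam D {v3, v0}) (lam D {v0, v2}) (mu D {v0, v1, v2}) (mu D {v0, v2, v3})"
    "mu D' {v0, v1, v3} = ptolemy_mu1 (lam D {v0, v1}) (lam D {v1, v2}) (lam D {v2, v3})
      (lam D {v3, v0}) (mu D {v0, v1, v2}) (mu D {v0, v2, v3})"
    "mu D' {v1, v2, v3} = ptolemy_mu2 (lam D {v0, v1}) (lam D {v1, v2}) (lam D {v2, v3})
      (lam D {v3, v0}) (mu D {v0, v1, v2}) (mu D {v0, v2, v3})"
    using t unfolding lam' mu' by simp_all
  note old = lam_old [OF sides(1)] lam_old [OF sides(2)] lam_old [OF sides(3)] lam_old [OF sides(4)]
  have neg: "A_mat Pos h (- s) = rho_mat ** (A_mat Pos h s ** rho_mat)" for h s
    unfolding A_mat_eq by (simp add: matrix_mul_assoc rho_conj_B)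
  note p = ptolemy_A_mat [OF quad_Pos quad_Od l]
  show "angle_mat Pos D' v0 v1 v3 = angle_mat Pos D v0 v1 v2 ** angle_mat Pos D v0 v2 v3"
    unfolding angle_mat_def ct unfolding h_length_def c old by (rule p(1))
  show "angle_mat Pos D v1 v2 v0 = rho_mat ** (angle_mat Pos D' v1 v2 v3 ** (rho_mat ** angle_mat Pos D' v1 v3 v0))"
    unfolding angle_mat_def ct unfolding h_length_def c old p(2) neg by (simp add: matrix_mul_assoc)
  show "angle_mat Pos D' v2 v3 v1 = angle_mat Pos D v2 v3 v0 ** (rho_mat ** (angle_mat Pos D v2 v0 v1 ** rho_mat))"
    unfolding angle_mat_def ct unfolding h_length_def c old p(3) neg by (simp add: matrix_mul_assoc)
  show "angle_mat Pos D v3 v0 v2 = angle_mat Pos D' v3 v0 v1 ** angle_mat Pos D' v3 v1 v2"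
    unfolding angle_mat_def ct unfolding h_length_def c old by (rule p(4))
qed

lemma edge_sign_flip:
  "edge_sign D v0 v2 = mat 1" "edge_sign D v2 v0 = rho_mat" "edge_sign D' v3 v1 = mat 1" "edge_sign D' v1 v3 = rho_mat"
  "edge_sign D' v1 v2 = rho_mat ** edge_sign D v1 v2" "edge_sign D' v2 v1 = rho_mat ** edge_sign D v2 v1"
  "{x, y} \<noteq> {v1, v3} \<Longrightarrow> {x, y} \<noteq> {v0, v2} \<Longrightarrow> {x, y} \<noteq> {v1, v2} \<Longrightarrow> edge_sign D' x y = edge_sign D x y"
proof -
  have "(v1, v2) \<in> orient D \<longleftrightarrow> (v2, v1) \<notin> orient D" using orient_iff sides by blast
  moreover have "{v1, v2} \<noteq> {v1, v3}" "{v1, v2} \<noteq> {v0, v2}" "{v2, v1} = {v1, v2}"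
    using distinct by (auto simp: doubleton_eq_iff)
  ultimately show "edge_sign D' v1 v2 = rho_mat ** edge_sign D v1 v2" "edge_sign D' v2 v1 = rho_mat ** edge_sign D v2 v1"
    unfolding edge_sign_def orient'_iff by (simp_all add: rho_mult_rho)
  show "edge_sign D v0 v2 = mat 1" "edge_sign D v2 v0 = rho_mat" "edge_sign D' v3 v1 = mat 1" "edge_sign D' v1 v3 = rho_mat"
    using oriented oriented' distinct unfolding edge_sign_def orient'_iff by (simp_all add: insert_commute)
  show "{x, y} \<noteq> {v1, v3} \<Longrightarrow> {x, y} \<noteq> {v0, v2} \<Longrightarrow> {x, y} \<noteq> {v1, v2} \<Longrightarrow> edge_sign D' x y = edge_sign D x y"
    unfolding edge_sign_def orient'_iff by simp
qed

text \<open>A triangle containing both \<open>v0\<close> and \<open>v2\<close> contains the old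
  diagonal, and \<open>triangle_unique\<close> then determines its third vertex.\<close>

lemma old_triangle_cases:
  assumes "{i, j, k} \<in> triangles (arcs D)"
  shows "{i, j, k} = {v0, v1, v2} \<or> {i, j, k} = {v0, v2, v3} \<or>
    {i, j, k} \<in> triangles (arcs D') \<and> \<not> {v0, v2} \<subseteq> {i, j, k}"
proof (cases "{v0, v2} \<subseteq> {i, j, k}")
  case True
  then have "{i, j, k} = {v0, v2, i} \<or> {i, j, k} = {v0, v2, j} \<or> {i, j, k} = {v0, v2, k}"
    using distinct by auto
  then obtain x where x: "{i, j, k} = {v0, v2, x}" by blast
  have t: "{v0, v2, v1} \<in> triangles (arcs D)" using t012 by (simp add: insert_commute)
  have "x = v1 \<or> x = v3"
    using triangle_unique [OF assms [unfolded x] t] triangle_unique [OF assms [unfolded x] t023]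
      cw_rotate cw012 cw230 cw_asym by metis
  then show ?thesis unfolding x by (auto simp: insert_commute)
next
  case False
  then have "{i, j} \<noteq> {v0, v2}" "{j, k} \<noteq> {v0, v2}" "{i, k} \<noteq> {v0, v2}" by auto
  then show ?thesis using assms False unfolding triangles_iff arcs' by simp
qed

text \<open>
  The matrices \<open>P\<close> are kept.  On the sides of the quadrilateral the potential is kept too, except for
  the sign forced by the reversal of \<open>v1v2\<close>; on the old diagonal it is determined by the angles.
\<close>

lemma realizes_flip:
  assumes "realizes Pos D' L' P"
  obtains L where "realizes Pos D L P"
proof -
  have N': "\<And>x y. {x, y} \<in> arcs D' \<Longrightarrow> invertible (P x) \<and> (\<exists>N. horocyclic N \<and> L' x y = N ** P x)"
    and S': "\<And>x y. {x, y} \<in> arcs D' \<Longrightarrow> edge_sign D' x y ** L' x y = E_mat (lam D' {x, y}) ** L' y x"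
    and A': "\<And>i j k. {i, j, k} \<in> triangles (arcs D') \<Longrightarrow> cw i j k \<Longrightarrow>
        L' i j = angle_mat Pos D' i j k ** (edge_sign D' i k ** L' i k)"
    using assms unfolding realizes_def by blast+
  define L where "L x y = (if (x, y) = (v1, v2) then rho_mat ** L' v1 v2
    else if (x, y) = (v0, v2) then angle_mat Pos D v0 v2 v3 ** (edge_sign D v0 v3 ** L' v0 v3)
    else if (x, y) = (v2, v0) then angle_mat Pos D v2 v0 v1 ** (edge_sign D v2 v1 ** L' v2 v1)
    else L' x y)" for x y
  have L: "L v1 v2 = rho_mat ** L' v1 v2"
    "L v0 v2 = angle_mat Pos D v0 v2 v3 ** (edge_sign D v0 v3 ** L' v0 v3)"
    "L v2 v0 = angle_mat Pos D v2 v0 v1 ** (edge_sign D v2 v1 ** L' v2 v1)"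
    "L v0 v1 = L' v0 v1" "L v1 v0 = L' v1 v0" "L v2 v1 = L' v2 v1" "L v2 v3 = L' v2 v3"
    "L v3 v2 = L' v3 v2" "L v3 v0 = L' v3 v0" "L v0 v3 = L' v0 v3"
    using distinct unfolding L_def by auto
  have L_other: "L u v = L' u v" if "{u, v} \<noteq> {v1, v2}" "{u, v} \<noteq> {v0, v2}" for u v
  proof -
    have "(u, v) \<noteq> (v1, v2)" "(u, v) \<noteq> (v0, v2)" "(u, v) \<noteq> (v2, v0)"
      using that by (auto simp: doubleton_eq_iff)
    then show ?thesis unfolding L_def by (simp only: if_False)
  qed
  have arcs_old: "{x, y} \<in> arcs D'" if "{x, y} \<in> arcs D" "{x, y} \<noteq> {v0, v2}" for x y
    using that unfolding arcs' by simp
  have sides': "{v0, v1} \<in> arcs D'" "{v1, v2} \<in> arcs D'" "{v2, v3} \<in> arcs D'" "{v3, v0} \<in> arcs D'"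
    using sides distinct by (simp_all add: arcs_old doubleton_eq_iff)
  have t': "{v0, v1, v3} \<in> triangles (arcs D')" "{v1, v2, v3} \<in> triangles (arcs D')"
  proof -
    have "{v1, v3} \<in> arcs D'" "{v0, v3} \<in> arcs D'"
      using sides'(4) unfolding arcs' by (auto simp: insert_commute)
    then show "{v0, v1, v3} \<in> triangles (arcs D')" "{v1, v2, v3} \<in> triangles (arcs D')"
      unfolding triangles_iff using sides' distinct by blast+
  qed
  have sq: "edge_sign D' v0 v1 = edge_sign D v0 v1" "edge_sign D' v1 v0 = edge_sign D v1 v0"
    "edge_sign D' v2 v3 = edge_sign D v2 v3" "edge_sign D' v3 v2 = edge_sign D v3 v2"
    "edge_sign D' v0 v3 = edge_sign D v0 v3" "edge_sign D' v3 v0 = edge_sign D v3 v0"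
    using distinct by (auto intro!: edge_sign_flip(7) simp: doubleton_eq_iff)
  have cw': "cw v0 v1 v3" "cw v1 v3 v0" "cw v3 v0 v1" "cw v2 v3 v1" "cw v3 v1 v2"
    using cw_rotate cw123 cw301 by blast+
  have tc: "{v1, v3, v0} = {v0, v1, v3}" "{v3, v0, v1} = {v0, v1, v3}"
     "{v2, v3, v1} = {v1, v2, v3}" "{v3, v1, v2} = {v1, v2, v3}" by auto
  note a' = A' [OF t'(1) cw'(1)] A' [of v1 v3 v0, unfolded tc, OF t'(1) cw'(2)]
    A' [of v3 v0 v1, unfolded tc, OF t'(1) cw'(3)] A' [OF t'(2) cw123]
    A' [of v2 v3 v1, unfolded tc, OF t'(2) cw'(4)] A' [of v3 v1 v2, unfolded tc, OF t'(2) cw'(5)]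
  note a'' = a' [unfolded edge_sign_flip sq flip_angles]
  \<comment> \<open>The relations for \<open>L v0 v2\<close> and \<open>L v2 v0\<close> hold by the
    choice of \<open>L\<close>. The other four combine relations in the new triangles through
    \<open>flip_angles\<close>.\<close>
  have new_angles:
    "L v0 v1 = angle_mat Pos D v0 v1 v2 ** (edge_sign D v0 v2 ** L v0 v2)"
    "L v1 v2 = angle_mat Pos D v1 v2 v0 ** (edge_sign D v1 v0 ** L v1 v0)"
    "L v2 v0 = angle_mat Pos D v2 v0 v1 ** (edge_sign D v2 v1 ** L v2 v1)"
    "L v0 v2 = angle_mat Pos D v0 v2 v3 ** (edge_sign D v0 v3 ** L v0 v3)"
    "L v2 v3 = angle_mat Pos D v2 v3 v0 ** (edge_sign D v2 v0 ** L v2 v0)"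
    "L v3 v0 = angle_mat Pos D v3 v0 v2 ** (edge_sign D v3 v2 ** L v3 v2)"
    unfolding L edge_sign_flip flip_angles(2,4) using a''
    by (simp_all flip: matrix_mul_assoc add: rho_cancel)
  have edge: "edge_sign D x y ** L x y = E_mat (lam D {x, y}) ** L y x"
    if xy: "{x, y} \<in> arcs D" "{x, y} \<noteq> {v0, v2}" for x y
  proof (cases "{x, y} = {v1, v2}")
    case True
    have "edge_sign D v1 v2 ** L v1 v2 = E_mat (lam D {v1, v2}) ** L v2 v1"
    proof -
      have "edge_sign D v1 v2 ** (rho_mat ** L' v1 v2) = rho_mat ** (edge_sign D v1 v2 ** L' v1 v2)"
        by (simp add: edge_sign_def)
      then show ?thesis
        using S' [OF sides'(2)] unfolding L edge_sign_flip lam_old [OF sides(2)]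
        by (simp flip: matrix_mul_assoc)
    qed
    then show ?thesis using edge_relation_sym [of v1 v2 L] sides True by (auto simp: doubleton_eq_iff)
  next
    case False
    have "{y, x} = {x, y}" by blast
    then have "L x y = L' x y" "L y x = L' y x"
      using L_other [of x y] L_other [of y x] False xy(2) by simp_all
    moreover have "edge_sign D' x y = edge_sign D x y"
      using edge_sign_flip(7) [of x y] False xy new_diagonal_notin by metis
    ultimately show ?thesis using S' [OF arcs_old [OF xy]] lam_old [OF xy(1)] by simp
  qed
  \<comment> \<open>Three angles and two sides of the triangle \<open>v0v1v2\<close> are settled,
    and flatness forces the relation on its third side.\<close>
  have "edge_sign D v0 v2 ** L v0 v2 = E_mat (lam D {v2, v0}) ** L v2 v0"
  proof (rule hexagon_side [OF t012 _ new_angles(2) _ new_angles(3,1)])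
    show "edge_sign D v1 v0 ** L v1 v0 = E_mat (lam D {v0, v1}) ** L v0 v1"
      using edge [of v1 v0] sides distinct by (simp add: insert_commute doubleton_eq_iff)
    show "edge_sign D v2 v1 ** L v2 v1 = E_mat (lam D {v1, v2}) ** L v1 v2"
      using edge [of v2 v1] sides distinct by (simp add: insert_commute doubleton_eq_iff)
  qed
  then have 02: "edge_sign D v0 v2 ** L v0 v2 = E_mat (lam D {v0, v2}) ** L v2 v0"
    by (simp add: insert_commute)
  have S: "edge_sign D x y ** L x y = E_mat (lam D {x, y}) ** L y x" if "{x, y} \<in> arcs D" for x y
    using edge [OF that] 02 edge_relation_sym [OF sides(5) 02] by (auto simp: doubleton_eq_iff)
  have N: "invertible (P x) \<and> (\<exists>N. horocyclic N \<and> L x y = N ** P x)" if xy: "{x, y} \<in> arcs D" for x y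
  proof -
    have h: "\<exists>N. horocyclic N \<and> M ** L' u v = N ** P u" if "{u, v} \<in> arcs D'" "horocyclic M" for u v M
      using N' [OF that(1)] horocyclic_mult [OF that(2)] by (metis matrix_mul_assoc)
    have ha: "\<exists>N. horocyclic N \<and> angle_mat Pos D a b c ** (edge_sign D u v ** L' u v) = N ** P u"
      if "{u, v} \<in> arcs D'" for u v a b c
      using h [OF that horocyclic_mult [OF horocyclic_angle_mat horocyclic_edge_sign]] by (simp flip: matrix_mul_assoc)
    show ?thesis
    proof (cases "{x, y} = {v0, v2}")
      case True
      then have "x = v0 \<and> y = v2 \<or> x = v2 \<and> y = v0" by (auto simp: doubleton_eq_iff)
      then show ?thesis
        using ha [of v0 v3] ha [of v2 v1] N' [of v0 v1] N' [of v2 v1] sides' unfolding L(2,3) [symmetric]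
        by (elim disjE) (auto simp: L(2,3) insert_commute)
    next
      case False
      note xy' = arcs_old [OF xy False]
      show ?thesis
      proof (cases "(x, y) = (v1, v2)")
        case True
        then show ?thesis using N' [OF xy'] h [OF xy' horocyclic_rho] L(1) by simp
      next
        case 12: False
        have "(x, y) \<noteq> (v0, v2)" "(x, y) \<noteq> (v2, v0)"
          using False by (auto simp: doubleton_eq_iff)
        with 12 have "L x y = L' x y" unfolding L_def by (simp only: if_False)
        then show ?thesis using N' [OF xy'] by simp
      qed
    qed
  qed
  have A: "L i j = angle_mat Pos D i j k ** (edge_sign D i k ** L i k)"
    if t: "{i, j, k} \<in> triangles (arcs D)" and c: "cw i j k" for i j k
    using old_triangle_cases [OF t]
  proof (elim disjE conjE)
    assume "{i, j, k} = {v0, v1, v2}"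
    from cw_same_triangle [OF this c cw012] show ?thesis using new_angles by auto
  next
    assume *: "{i, j, k} = {v0, v2, v3}"
    have "cw v0 v2 v3" using cw_rotate cw230 by blast
    from cw_same_triangle [OF * c this] show ?thesis using new_angles by auto
  next
    assume ijk: "{i, j, k} \<in> triangles (arcs D')" "\<not> {v0, v2} \<subseteq> {i, j, k}"
    \<comment> \<open>Outside the quadrilateral, the modified value \<open>L v1 v2\<close> can only
      occur in the position of \<open>L i k\<close>. There its factor \<open>rho_mat\<close> is
      compensated by the reversed orientation of \<open>v1v2\<close>.\<close>
    have inner: "x = v0" if "{v1, v2, x} \<in> triangles (arcs D)" "cw v1 v2 x" for x
      using triangle_unique [OF that(1), of v0] that(2) t012 cw_rotate [OF cw012]
      by (simp add: insert_commute)
    have ij: "(i, j) \<noteq> (v1, v2)" using inner [of k] t c ijk(2) by auto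
    have ik: "(i, k) \<noteq> (v2, v1)" using inner [of j] t c ijk(2) cw_rotate by (auto simp: insert_commute)
    have arc: "{i, k} \<in> arcs D" "{i, j} \<in> arcs D" "{j, k} \<in> arcs D" using t by (auto simp: triangles_iff)
    have Lother: "L u v = L' u v" if "u \<in> {i, j, k}" "v \<in> {i, j, k}" "(u, v) \<noteq> (v1, v2)" for u v
    proof -
      have "(u, v) \<noteq> (v0, v2)" "(u, v) \<noteq> (v2, v0)" using that(1,2) ijk(2) by auto
      with that(3) show ?thesis unfolding L_def by (simp only: if_False)
    qed
    have Lij: "L i j = L' i j" using Lother ij by simp
    have Lik: "edge_sign D i k ** L i k = edge_sign D' i k ** L' i k"
    proof (cases "(i, k) = (v1, v2)")
      case True
      then show ?thesis using edge_sign_flip(5) L(1) by (simp add: edge_sign_def rho_mult_rho rho_cancel)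
    next
      case False
      then have "{i, k} \<noteq> {v1, v2}" using ik by (auto simp: doubleton_eq_iff)
      moreover have "{i, k} \<noteq> {v0, v2}" using ijk(2) by (auto simp: doubleton_eq_iff)
      moreover have "{i, k} \<noteq> {v1, v3}" using arc(1) new_diagonal_notin by metis
      ultimately have "edge_sign D' i k = edge_sign D i k" by (intro edge_sign_flip(7))
      then show ?thesis using Lother [of i k] False by simp
    qed
    have "angle_mat Pos D' i j k = angle_mat Pos D i j k"
      unfolding angle_mat_def h_length_def by (simp add: lam_old arc mu_old t)
    then show ?thesis using A' [OF ijk(1) c] Lij Lik by simp
  qed
  have "realizes Pos D L P" unfolding realizes_def using N S A by blast
  then show thesis by (rule that)
qed

end

section \<open>The potential of a fan\<close>

context decorated_triangulation
begin

text \<open>If a triangle avoided \<open>i\<close>, the arc from \<open>i\<close> to its middle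
  vertex, in clockwise order from \<open>i\<close>, would cross the opposite side.\<close>

lemma fan_triangle:
  assumes "is_fan n i (arcs D)" "i < n" "{x, y, z} \<in> triangles (arcs D)"
  shows "i \<in> {x, y, z}"
proof (rule ccontr)
  assume i: "i \<notin> {x, y, z}"
  have t: "{x, y} \<in> arcs D" "{y, z} \<in> arcs D" "{x, z} \<in> arcs D" "x \<noteq> y" "y \<noteq> z" "x \<noteq> z"
    using assms(3) by (auto simp: triangles_iff)
  have f: "{i, x} \<in> arcs D" "{i, y} \<in> arcs D" "{i, z} \<in> arcs D"
    using assms(1) i arc_bounds [OF t(1)] arc_bounds [OF t(2)] unfolding is_fan_def by auto
  have *: False if "{a, b} \<in> arcs D" "{b, c} \<in> arcs D" "{a, c} \<in> arcs D" "{i, b} \<in> arcs D"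
    "cw i a b" "cw i b c" for a b c
  proof -
    have "cw a b c" "cw c i a" using that(5,6) unfolding cw_def by auto
    then show False using noncrossing [OF that(3), of b i] that(4) by (simp add: insert_commute)
  qed
  have "cw i x y \<and> cw i y z \<or> cw i x z \<and> cw i z y \<or> cw i y x \<and> cw i x z \<or>
    cw i y z \<and> cw i z x \<or> cw i z x \<and> cw i x y \<or> cw i z y \<and> cw i y x"
    using i t(4-6) cw_total [of i x y] cw_total [of i y z] cw_total [of i x z] by auto
  then show False
    using * [of x y z] * [of x z y] * [of y x z] * [of y z x] * [of z x y] * [of z y x] t f
    by (auto simp: insert_commute)
qed

text \<open>Otherwise the successor of \<open>x\<close> lies strictly between \<open>x\<close> and
  \<open>y\<close>, and its arc to \<open>i\<close> crosses \<open>xy\<close>.\<close>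

lemma fan_triangle_offset:
  assumes "is_fan n i (arcs D)" "i < n" "{i, x, y} \<in> triangles (arcs D)" "cw i x y"
  shows "offset i y = Suc (offset i x)"
proof (rule ccontr)
  assume neq: "offset i y \<noteq> Suc (offset i x)"
  have xy: "{x, y} \<in> arcs D" using assms(3) by (simp add: triangles_iff)
  then have n: "x < n" "y < n" using arc_bounds by auto
  define z where "z = Suc x mod n"
  have z: "z < n" "cw x z y" "z \<noteq> i"
    using n assms(2,4) neq unfolding z_def offset_def cw_def
    by (cases "Suc x = n"; auto split: if_splits)+
  then have "{i, z} \<in> arcs D" using assms(1) unfolding is_fan_def by auto
  moreover have "cw y i x" using assms(4) cw_rotate by blast
  ultimately show False using noncrossing [OF xy, of z i] z(2) by (simp add: insert_commute)
qed

lemma offset_inverse: "i < n \<Longrightarrow> x < n \<Longrightarrow> (i + offset i x) mod n = x"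
  unfolding offset_def by auto

lemma fan_realizes:
  assumes fan: "is_fan n i (arcs D)" and i: "i < n"
  obtains L P where "realizes Pos D L P"
    "\<And>j. j < n \<Longrightarrow> j \<noteq> i \<Longrightarrow> \<exists>X. P j = X ** P i \<and> X $ 1 $ 2 \<in> {lam D {i, j}, - lam D {i, j}}"
proof -
  define q where "q m = (i + m) mod n" for m
  \<comment> \<open>The angle relation at \<open>i\<close>, solved for the next value. Index 0 is
    the vertex \<open>i\<close> itself, so \<open>g 1\<close> comes from a degenerate angle. It is
    still horocyclic and acts as an arbitrary starting value.\<close>
  define g where "g = rec_nat (mat 1) (\<lambda>m M. edge_sign D i (q (Suc m)) **
     (matrix_inv (angle_mat Pos D i (q m) (q (Suc m))) ** M))"
  have g_Suc: "g m = angle_mat Pos D i (q m) (q (Suc m)) ** (edge_sign D i (q (Suc m)) ** g (Suc m))" for m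
    unfolding g_def by (simp add: edge_sign_cancel matrix_inv_cancel [OF horocyclic_invertible [OF horocyclic_angle_mat]])
  have g_horocyclic: "horocyclic (g m)" for m
    by (induction m)
      (auto simp: g_def intro!: horocyclic_one horocyclic_mult horocyclic_edge_sign horocyclic_inverse horocyclic_angle_mat)
  \<comment> \<open>The potential spreads from \<open>i\<close>: \<open>C\<close> along the arcs at
    \<open>i\<close>, \<open>S\<close> at their other ends, and \<open>R\<close> along the outer
    side of each triangle. All relations but the last angle of each triangle are built in.\<close>
  define C where "C x = g (offset i x)" for x
  define S where "S x = edge_sign D x i ** (E_mat (lam D {i, x}) ** C x)" for x
  define R where "R x y = angle_mat Pos D x y i ** (edge_sign D x i ** S x)" for x y
  define L where "L x y = (if x = i then C y else if y = i then S x
     else if cw i x y then R x y else edge_sign D x y ** (E_mat (lam D {x, y}) ** R y x))" for x y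
  define P where "P x = (if x = i then mat 1 else S x)" for x
  have fan_arc: "{i, x} \<in> arcs D" if "x < n" "x \<noteq> i" for x
    using fan that unfolding is_fan_def by blast
  have edge_i: "edge_sign D x i ** L x i = E_mat (lam D {x, i}) ** L i x" if "{x, i} \<in> arcs D" for x
  proof -
    have "x \<noteq> i" using arc_bounds [OF that] by blast
    then show ?thesis unfolding L_def S_def by (simp add: edge_sign_cancel insert_commute)
  qed
  have edge_out: "edge_sign D y x ** L y x = E_mat (lam D {y, x}) ** L x y" if "{x, y} \<in> arcs D" "cw i x y" for x y
    using cw_distinct [OF that(2)] that(2) cw_asym [OF that(2)] unfolding L_def by (simp add: edge_sign_cancel)
  have edge: "edge_sign D x y ** L x y = E_mat (lam D {x, y}) ** L y x" if xy: "{x, y} \<in> arcs D" for x y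
  proof -
    have yx: "{y, x} \<in> arcs D" using xy by (simp add: insert_commute)
    consider "y = i" | "x = i" | "cw i x y" | "cw i y x"
      using arc_bounds [OF xy] cw_total [of i x y] by blast
    then show ?thesis
    proof cases
      case 1 then show ?thesis using edge_i xy by blast
    next
      case 2
      then show ?thesis using edge_relation_sym [OF yx, of L] edge_i [of y] yx by blast
    next
      case 3
      then show ?thesis using edge_relation_sym [OF yx, of L] edge_out [OF xy] by blast
    next
      case 4
      then show ?thesis using edge_out [OF yx] by blast
    qed
  qed
  have angles: "L i x = angle_mat Pos D i x y ** (edge_sign D i y ** L i y)"
    "L x y = angle_mat Pos D x y i ** (edge_sign D x i ** L x i)"
    "L y i = angle_mat Pos D y i x ** (edge_sign D y x ** L y x)"
    if t: "{i, x, y} \<in> triangles (arcs D)" and c: "cw i x y" for x y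
  proof -
    have d: "x \<noteq> i" "y \<noteq> i" "x \<noteq> y" using cw_distinct c by blast+
    have arc: "{i, x} \<in> arcs D" "{x, y} \<in> arcs D" "{i, y} \<in> arcs D"
      using t by (auto simp: triangles_iff)
    then have n: "x < n" "y < n" using arc_bounds by auto
    have off: "offset i y = Suc (offset i x)" by (rule fan_triangle_offset [OF fan i t c])
    have q: "q (offset i x) = x" "q (Suc (offset i x)) = y"
      using offset_inverse [OF i n(1)] offset_inverse [OF i n(2)] unfolding q_def off by auto
    show 1: "L i x = angle_mat Pos D i x y ** (edge_sign D i y ** L i y)"
      using g_Suc [of "offset i x"] d unfolding L_def C_def off q by simp
    show 2: "L x y = angle_mat Pos D x y i ** (edge_sign D x i ** L x i)"
      using d c unfolding L_def R_def by simp
    have "{y, x} \<in> arcs D" "{x, i} \<in> arcs D" using arc by (simp_all add: insert_commute)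
    \<comment> \<open>This closes the hexagon, so it follows from the other five relations.\<close>
    then show "L y i = angle_mat Pos D y i x ** (edge_sign D y x ** L y x)"
      using edge [of x i] edge [of y x] edge [OF arc(3)]
      by (intro hexagon_angle [OF t _ 2 _ _ 1]) (simp_all add: insert_commute)
  qed
  have angle: "L a b = angle_mat Pos D a b c ** (edge_sign D a c ** L a c)"
    if t: "{a, b, c} \<in> triangles (arcs D)" and c: "cw a b c" for a b c
  proof -
    have r: "cw b c a" "cw c a b" "{b, c, a} = {a, b, c}" "{c, a, b} = {a, b, c}"
      using c cw_rotate by blast+
    have "i \<in> {a, b, c}" by (rule fan_triangle [OF fan i t])
    then show ?thesis
      using angles(1) [of b c] angles(2) [of a b] angles(3) [of c a] t c r by auto
  qed
  have inv: "invertible (P x) \<and> (\<exists>N. horocyclic N \<and> L x y = N ** P x)" if xy: "{x, y} \<in> arcs D" for x y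
  proof (cases "x = i")
    case True
    then show ?thesis using g_horocyclic horocyclic_invertible [OF horocyclic_one] unfolding P_def L_def C_def by auto
  next
    case False
    have n: "x < n" "y < n" "x \<noteq> y" using arc_bounds [OF xy] by auto
    have ix: "{i, x} \<in> arcs D" using fan_arc n(1) False by blast
    have "invertible (S x)"
      unfolding S_def C_def
      by (intro invertible_mult horocyclic_invertible [OF horocyclic_edge_sign] horocyclic_invertible [OF g_horocyclic]
          invertible_E_mat lam_Pos ix)
    then have P: "invertible (P x)" using False unfolding P_def by simp
    have Px: "P x = L x i" using False unfolding P_def L_def by simp
    have "\<exists>N. horocyclic N \<and> L x y = N ** L x i"
    proof (cases "y = i")
      case True
      then show ?thesis using horocyclic_one by (metis matrix_mul_lid)
    next
      case y: False
      then have iy: "{i, y} \<in> arcs D" using fan_arc n(2) by blast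
      have t: "{i, x, y} \<in> triangles (arcs D)" "{i, y, x} \<in> triangles (arcs D)"
        using ix iy xy False y n(3) by (simp_all add: triangles_iff insert_commute)
      consider "cw i x y" | "cw i y x" using cw_total [of i x y] False y n(3) by blast
      then show ?thesis
      proof cases
        case 1
        have "horocyclic (angle_mat Pos D x y i ** edge_sign D x i)"
          by (intro horocyclic_mult horocyclic_angle_mat horocyclic_edge_sign)
        then show ?thesis using angles(2) [OF t(1) 1] by (metis matrix_mul_assoc)
      next
        case 2
        have "horocyclic (edge_sign D x y ** matrix_inv (angle_mat Pos D x i y))"
          by (intro horocyclic_mult horocyclic_angle_mat horocyclic_edge_sign horocyclic_inverse)
        moreover have "L x y = edge_sign D x y ** (matrix_inv (angle_mat Pos D x i y) ** L x i)"
          unfolding angles(3) [OF t(2) 2]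
          by (simp add: edge_sign_cancel matrix_inv_cancel [OF horocyclic_invertible [OF horocyclic_angle_mat]])
        ultimately show ?thesis by (metis matrix_mul_assoc)
      qed
    qed
    then show ?thesis using P Px by simp
  qed
  have "realizes Pos D L P" unfolding realizes_def using inv edge angle by blast
  moreover have "\<exists>X. P j = X ** P i \<and> X $ 1 $ 2 \<in> {lam D {i, j}, - lam D {i, j}}"
    if "j < n" "j \<noteq> i" for j
  proof -
    \<comment> \<open>\<open>P i\<close> is the identity, and \<open>S j\<close> is an
      \<open>E_mat\<close> between two horocyclic matrices.\<close>
    have "P j = S j ** P i" using that unfolding P_def by simp
    moreover have "S j $ 1 $ 2 \<in> {lam D {i, j}, - lam D {i, j}}"
      using horocyclic_entry [OF horocyclic_edge_sign [of D j i] g_horocyclic [of "offset i j"], of "E_mat (lam D {i, j})"]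
      unfolding S_def C_def by (auto simp: E_mat_def)
    ultimately show ?thesis by blast
  qed
  ultimately show thesis by (rule that)
qed

end

section \<open>Transport along flips and comparison of lengths\<close>

context positive_superalgebra
begin

lemma decorated_flips:
  assumes "(super_flip Pos)\<^sup>*\<^sup>* D E" "3 \<le> n" "decorated_polygon Od Pos n D"
  shows "decorated_polygon Od Pos n E"
  using assms(1)
proof induction
  case base
  show ?case by (rule assms(3))
next
  case (step E F)
  then obtain v0 v1 v2 v3 where "ptolemy_flip Ev Od Pos n E v0 v1 v2 v3 F"
    using super_flip_cases assms(2) by blast
  then show ?case by (rule ptolemy_flip.decorated')
qed

text \<open>Pulling back starts with the last flip. The family \<open>P\<close> is the same
  throughout, and it alone determines the (1,2)-entries up to sign.\<close>

lemma realizes_flips: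
  assumes "(super_flip Pos)\<^sup>*\<^sup>* D E" "3 \<le> n" "decorated_polygon Od Pos n D" "realizes Pos E L P"
  shows "\<exists>L. realizes Pos D L P"
  using assms(1,3)
proof (induction rule: converse_rtranclp_induct)
  case base
  show ?case using assms(4) by blast
next
  case (step D D')
  then obtain v0 v1 v2 v3 where flip: "ptolemy_flip Ev Od Pos n D v0 v1 v2 v3 D'"
    using super_flip_cases assms(2) by blast
  then obtain L' where "realizes Pos D' L' P"
    using step.IH ptolemy_flip.decorated' by blast
  then show ?case using ptolemy_flip.realizes_flip [OF flip] by blast
qed

text \<open>\<open>D'\<close> is any decoration reached by flips, while \<open>H\<close> belongs to
  \<open>D\<close>. One statement thus gives the value of the entry and the comparison of different
  sequences of flips.\<close>

lemma holonomy_lambda: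
  assumes "3 \<le> n" "decorated_polygon Od Pos n D" "(super_flip Pos)\<^sup>*\<^sup>* D D'" "{i, j} \<in> arcs D'"
    and "near (arcs D) i u" "near (arcs D) j v" "holonomy Pos D u v H"
  shows "lam D' {i, j} \<in> Pos" "H $ 1 $ 2 \<in> {lam D' {i, j}, - lam D' {i, j}}"
proof -
  note dt = decorated_triangulationI [OF positive_superalgebra_axioms assms(1)]
  note dec' = decorated_flips [OF assms(3,1,2)]
  interpret d: decorated_triangulation Ev Od Pos n D by (rule dt [OF assms(2)])
  interpret d': decorated_triangulation Ev Od Pos n D' by (rule dt [OF dec'])
  show "lam D' {i, j} \<in> Pos" by (rule d'.lam_Pos [OF assms(4)])
  have n: "i < n" "j < n" "j \<noteq> i" using d'.arc_bounds [OF assms(4)] by auto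
  obtain F where F: "(super_flip Pos)\<^sup>*\<^sup>* D' F" "decorated_polygon Od Pos n F" "is_fan n i (arcs F)"
    "lam F {i, j} = lam D' {i, j}"
    using fan_reachable [OF assms(1) n(1) dec'] assms(4) by blast
  interpret f: decorated_triangulation Ev Od Pos n F by (rule dt [OF F(2)])
  obtain LF P where LF: "realizes Pos F LF P"
    and "\<And>j. j < n \<Longrightarrow> j \<noteq> i \<Longrightarrow> \<exists>X. P j = X ** P i \<and> X $ 1 $ 2 \<in> {lam F {i, j}, - lam F {i, j}}"
    using f.fan_realizes [OF F(3) n(1)] by blast
  then obtain X where X: "P j = X ** P i" "X $ 1 $ 2 \<in> {lam D' {i, j}, - lam D' {i, j}}"
    using n(2,3) F(4) by metis
  have "(super_flip Pos)\<^sup>*\<^sup>* D F" using assms(3) F(1) by simp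
  then obtain L where "realizes Pos D L P"
    using realizes_flips assms(1,2) LF by blast
  from d.holonomy_entry [OF this assms(5-7) X(1)] X(2)
  show "H $ 1 $ 2 \<in> {lam D' {i, j}, - lam D' {i, j}}" by auto
qed

text \<open>Otherwise \<open>x\<close> and \<open>y\<close> would be opposite, and their sum 0 would
  be positive, hence invertible.\<close>

lemma Pos_sign_unique:
  assumes "x \<in> Pos" "y \<in> Pos" "z \<in> {x, - x}" "z \<in> {y, - y}"
  shows "x = y"
proof (rule ccontr)
  assume "x \<noteq> y"
  then have "x + y = 0" using assms(3,4) by auto
  then show False using Pos_add [OF assms(1,2)] zero_notin_Pos by simp
qed

end

theorem theorem3p10:
  fixes Ev Od Pos :: "'a::real_algebra_1 set"
    and D :: "'a decoration"
    and n i j :: nat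
    and i' j' :: gvertex
    and H :: "'a^3^3"
  assumes "positive_superalgebra Ev Od Pos"
    and "3 \<le> n"
    and "decorated_polygon Od Pos n D"
    and "i < n" and "j < n" and "i \<noteq> j"
    and "near (arcs D) i i'"
    and "near (arcs D) j j'"
    and "holonomy Pos D i' j' H"
  shows "H $ 1 $ 2 = lambda_length Pos D i j \<or> H $ 1 $ 2 = - lambda_length Pos D i j"
proof -
  interpret positive_superalgebra Ev Od Pos by (rule assms(1))
  obtain F where F: "(super_flip Pos)\<^sup>*\<^sup>* D F" "{i, j} \<in> arcs F"
    using fan_reachable [OF assms(2,4,3)] assms(5,6) unfolding is_fan_def by auto
  note hol = holonomy_lambda [OF assms(2,3) _ _ assms(7-9)]
  have "lambda_length Pos D i j = lam F {i, j}"
    unfolding lambda_length_def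
  proof (rule the_equality)
    show "\<exists>D'. (super_flip Pos)\<^sup>*\<^sup>* D D' \<and> {i, j} \<in> arcs D' \<and> lam F {i, j} = lam D' {i, j}"
      using F by blast
  next
    fix x assume "\<exists>D'. (super_flip Pos)\<^sup>*\<^sup>* D D' \<and> {i, j} \<in> arcs D' \<and> x = lam D' {i, j}"
    then obtain D' where D': "(super_flip Pos)\<^sup>*\<^sup>* D D'" "{i, j} \<in> arcs D'" "x = lam D' {i, j}"
      by blast
    \<comment> \<open>Both lengths equal the same entry of \<open>H\<close> up to sign.\<close>
    show "x = lam F {i, j}"
      unfolding D'(3)
      by (rule Pos_sign_unique [OF hol(1) [OF D'(1,2)] hol(1) [OF F] hol(2) [OF D'(1,2)] hol(2) [OF F]])
  qed
  then show ?thesis using hol(2) [OF F] by auto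
qed

end
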